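(* Let $A$ be a selfadjoint (possibly unbounded) linear operator in a complex Hilbert space $H$ with null space $N$. Let $f\in H$ and let $y$ in the domain of $A$ satisfy $Ay=f$ and $y\perp N$. Let $a:[0,\infty)\to(0,\infty)$ be a continuous, differentiable function decaying monotonically to $0$ as $t\to\infty$ and such that $$a'+a^2\in L^1(0,\infty),\qquad \int_0^\infty a(s)\,ds=\infty .$$ For $\delta>0$ let $f_\delta\in H$ satisfy $\|f_\delta-f\|\le\delta$, and let $u_\delta(t)$, $t\ge0$, be the solution of $$\dot u_\delta=i(A+ia(t))u_\delta-if_\delta,\qquad u_\delta(0)=0 .$$ Then there exists a stopping time $t_\delta$, with $\lim_{\delta\to0}t_\delta=\infty$, such that $$\lim_{\delta\to0}\|u_\delta(t_\delta)-y\|=0 .$$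
   Context: $N=N(A)=\{u: Au=0\}$ is the null space of $A$; $\dot u=du/dt$; $A+ia(t)$ means $A+ia(t)I$ with $I$ the identity. Selfadjoint operators are densely defined and closed. The solution of the Cauchy problem (understood in the mild sense if $A$ is unbounded) is $u_\delta(t)=\int_0^t e^{iA(t-s)-\int_s^t a(p)\,dp}(-if_\delta)\,ds$. *)

theory Defs
  imports "HOL-Analysis.Analysis"
begin

text \<open>
  Complex Hilbert spaces. The inherited real structure is the one underlying the complex
  structure, so that the norm is the one induced by the complex inner product.
  The inner product is linear in the first and conjugate linear in the second argument.
\<close>

class complex_hilbert_space = real_inner + banach +
  fixes scaleC :: "complex \<Rightarrow> 'a \<Rightarrow> 'a"  (infixr \<open>*\<^sub>C\<close> 75)
    and cinner :: "'a \<Rightarrow> 'a \<Rightarrow> complex"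
  assumes scaleC_add_right: "c *\<^sub>C (x + y) = c *\<^sub>C x + c *\<^sub>C y"
    and scaleC_add_left: "(c + d) *\<^sub>C x = c *\<^sub>C x + d *\<^sub>C x"
    and scaleC_scaleC: "c *\<^sub>C (d *\<^sub>C x) = (c * d) *\<^sub>C x"
    and scaleR_scaleC: "r *\<^sub>R x = complex_of_real r *\<^sub>C x"
    and cinner_commute: "cinner x y = cnj (cinner y x)"
    and cinner_add_left: "cinner (x + y) z = cinner x z + cinner y z"
    and cinner_scaleC_left: "cinner (c *\<^sub>C x) y = c * cinner x y"
    and inner_eq_Re_cinner: "inner x y = Re (cinner x y)"

instantiation complex :: complex_hilbert_space
begin

definition scaleC_complex :: "complex \<Rightarrow> complex \<Rightarrow> complex"
  where "scaleC_complex c x = c * x"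

definition cinner_complex :: "complex \<Rightarrow> complex \<Rightarrow> complex"
  where "cinner_complex x y = x * cnj y"

instance
  by standard
    (auto simp: scaleC_complex_def cinner_complex_def algebra_simps scaleR_conv_of_real
      inner_complex_def)

end

definition clinear_on :: "'a::complex_hilbert_space set \<Rightarrow> ('a \<Rightarrow> 'a) \<Rightarrow> bool"
  where "clinear_on D A \<longleftrightarrow>
    0 \<in> D \<and>
    (\<forall>x\<in>D. \<forall>y\<in>D. x + y \<in> D \<and> A (x + y) = A x + A y) \<and>
    (\<forall>c. \<forall>x\<in>D. c *\<^sub>C x \<in> D \<and> A (c *\<^sub>C x) = c *\<^sub>C A x)"

text \<open>
  An unbounded operator is given by its domain \<open>D\<close> and a function \<open>A\<close> whose values
  outside \<open>D\<close> are irrelevant. For a densely defined operator, the pairs \<open>(v, w)\<close> below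
  form the graph of the adjoint, so the last conjunct of selfadjointness expresses the equality of
  the operator and its adjoint, including equality of their domains.
\<close>

definition adjoint_graph :: "'a::complex_hilbert_space set \<Rightarrow> ('a \<Rightarrow> 'a) \<Rightarrow> ('a \<times> 'a) set"
  where "adjoint_graph D A = {(v, w). \<forall>u\<in>D. cinner (A u) v = cinner u w}"

definition selfadjoint :: "'a::complex_hilbert_space set \<Rightarrow> ('a \<Rightarrow> 'a) \<Rightarrow> bool"
  where "selfadjoint D A \<longleftrightarrow>
    clinear_on D A \<and> closure D = UNIV \<and> adjoint_graph D A = {(v, A v) | v. v \<in> D}"

definition null_space :: "'a::complex_hilbert_space set \<Rightarrow> ('a \<Rightarrow> 'a) \<Rightarrow> 'a set"
  where "null_space D A = {u \<in> D. A u = 0}"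

definition unitary :: "('a::complex_hilbert_space \<Rightarrow> 'a) \<Rightarrow> bool"
  where "unitary V \<longleftrightarrow>
    clinear_on UNIV V \<and> surj V \<and> (\<forall>x y. cinner (V x) (V y) = cinner x y)"

definition unitary_group :: "(real \<Rightarrow> 'a::complex_hilbert_space \<Rightarrow> 'a) \<Rightarrow> bool"
  where "unitary_group U \<longleftrightarrow>
    (\<forall>t. unitary (U t)) \<and> (\<forall>x. U 0 x = x) \<and> (\<forall>s t x. U (s + t) x = U s (U t x)) \<and>
    (\<forall>x. continuous_on UNIV (\<lambda>t. U t x))"

definition generator_graph :: "(real \<Rightarrow> 'a::complex_hilbert_space \<Rightarrow> 'a) \<Rightarrow> ('a \<times> 'a) set"
  where "generator_graph U = {(x, z). ((\<lambda>h. (U h x - x) /\<^sub>R h) \<longlongrightarrow> z) (at 0)}"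

text \<open>
  \<open>exp_i D A t\<close> is the operator \<open>e\<^sup>i\<^sup>t\<^sup>A\<close> for selfadjoint \<open>A\<close>: by Stone's theorem there is exactly
  one strongly continuous one-parameter unitary group whose generator is \<open>i A\<close>, with domain
  exactly \<open>D\<close>.
\<close>

definition exp_i ::
    "'a::complex_hilbert_space set \<Rightarrow> ('a \<Rightarrow> 'a) \<Rightarrow> real \<Rightarrow> 'a \<Rightarrow> 'a"
  where "exp_i D A =
    (THE U. unitary_group U \<and> generator_graph U = {(x, \<i> *\<^sub>C A x) | x. x \<in> D})"

text \<open>
  The mild solution of \<open>u' = i (A + i a(t)) u - i g\<close>, \<open>u(0) = 0\<close>, given by the variation of constants
  formula. The integrand is norm continuous, so the vector-valued gauge integral (which, unlike the
  Bochner integral of the library, does not need separability) is adequate.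
\<close>

definition mild_solution ::
    "'a::complex_hilbert_space set \<Rightarrow> ('a \<Rightarrow> 'a) \<Rightarrow> (real \<Rightarrow> real) \<Rightarrow> 'a \<Rightarrow> real \<Rightarrow> 'a"
  where "mild_solution D A a g t =
    integral {0..t} (\<lambda>s. exp (- integral {s..t} a) *\<^sub>R exp_i D A (t - s) ((- \<i>) *\<^sub>C g))"

end

theory Submission
  imports Defs
begin

text \<open>
  Write \<open>g t s = exp (- \<integral>\<^sub>s\<^sup>t a)\<close> for the damping factor, \<open>U t = e\<^sup>i\<^sup>t\<^sup>A\<close>, and \<open>G = i A\<close> for the generator of
  \<open>U\<close>, so that \<open>- i f = - G y\<close>. The data error contributes at most \<open>\<delta> t\<close> to \<open>u\<^sub>\<delta> t\<close>, because the damping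
  factor is at most one and \<open>U\<close> is isometric. With the stopping time \<open>t = 1 / \<surd>\<delta>\<close> this contribution
  is \<open>\<surd>\<delta>\<close>, so it remains to see that with exact data the solution converges to \<open>y\<close> as \<open>t\<close> grows.

  Since \<open>U (t - s) (G y) = - d/ds U (t - s) y\<close>, integration by parts
  (\<open>integral_by_parts\<close>) turns that solution into
  \<open>y - g t 0 U t y - \<integral>\<^sub>0\<^sup>t a s g t s U (t - s) y ds\<close>. The middle term vanishes because the integral of \<open>a\<close>
  diverges. The last term is an average of the orbit of \<open>y\<close>: the weights \<open>a s g t s\<close> are positive of
  total mass at most one, so these averages are contractions, uniformly in \<open>t\<close>. On vectors \<open>G x\<close> a second
  integration by parts moves the derivative to the weight, whose derivative is \<open>(a' + a\<^sup>2) g\<close>; this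
  leaves boundary terms that vanish and the integral of an integrable function against a
  factor that tends to zero (\<open>norm_average_range_le\<close>). Contractivity extends the decay to the closure of the
  range of \<open>G\<close> (\<open>average_tendsto_0\<close>), and this closure is the orthogonal complement of the null space, where
  \<open>y\<close> lies. This is von Neumann's proof of the mean ergodic theorem with a different kind of average.

  For unbounded \<open>A\<close> the group itself has to be constructed: this is Stone's theorem. The construction uses
  only the real inner product, for which \<open>i A\<close> is skew-adjoint. A graph argument with the projection theorem
  shows that \<open>1 - l G\<close> maps the domain bijectively onto the space for every real \<open>l \<noteq> 0\<close>. Scaled
  differences of its inverses at \<open>l\<close> and \<open>-l\<close> yield commuting bounded skew operators that approximate \<open>G\<close>
  on its domain; their exponentials are given by power series, are isometric, and converge
  (\<open>generated_group_stone_group\<close>). The limit has generator exactly \<open>G\<close>, and it is the only such group because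
  the norm of the difference of two solutions of \<open>u' = G u\<close> is constant. Complex linearity follows
  from uniqueness, as multiplication by \<open>i\<close> maps solutions to solutions (\<open>exp_i_generated_group\<close>).
\<close>

section \<open>Orthogonal projection onto a closed subspace\<close>

lemma norm_minus_sq_parallelogram:
  fixes p q x :: "'a::real_inner"
  shows "(norm (p - q))\<^sup>2 = 2 * (norm (x - p))\<^sup>2 + 2 * (norm (x - q))\<^sup>2
    - 4 * (norm (x - (1/2) *\<^sub>R (p + q)))\<^sup>2"
  by (simp add: power2_norm_eq_inner algebra_simps inner_commute)

lemma orthogonal_if_minimizing:
  fixes z s :: "'a::real_inner"
  assumes min: "\<And>r. norm z \<le> norm (z - r *\<^sub>R s)"
  shows "inner z s = 0"
proof (cases "s = 0")
  case False
  \<comment> \<open>The minimizer of the quadratic \<open>r \<mapsto> norm (z - r s)\<^sup>2\<close>.\<close>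
  define r where "r = inner z s / (norm s)\<^sup>2"
  have "(norm z)\<^sup>2 \<le> (norm (z - r *\<^sub>R s))\<^sup>2"
    using min[of r] by (simp add: power_mono)
  also have "\<dots> = (norm z)\<^sup>2 - 2 * r * inner z s + r\<^sup>2 * (norm s)\<^sup>2"
    unfolding power2_norm_eq_inner unfolding power2_eq_square
    by (simp only: inner_diff_left inner_diff_right inner_commute[of s z] inner_scaleR_left inner_scaleR_right)
      (simp add: algebra_simps)
  also have "\<dots> = (norm z)\<^sup>2 - (inner z s)\<^sup>2 / (norm s)\<^sup>2"
    using False by (simp add: r_def field_simps power2_eq_square)
  finally have "(inner z s)\<^sup>2 / (norm s)\<^sup>2 \<le> 0" by simp
  then show ?thesis using False
    by (simp add: divide_le_0_iff)
qed simp

text \<open>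
  A minimizing sequence for the distance to \<open>S\<close> is Cauchy by the parallelogram identity, because the midpoint
  of two of its members lies in \<open>S\<close> again. Its limit is a nearest point, and
  first-order optimality gives orthogonality.
\<close>

lemma closed_subspace_projection:
  fixes S :: "'a::{real_inner,banach} set"
  assumes S: "subspace S" "closed S"
  obtains p where "p \<in> S" "\<And>s. s \<in> S \<Longrightarrow> inner (x - p) s = 0"
proof -
  have ne: "S \<noteq> {}" using subspace_0[OF S(1)] by auto
  define d where "d = infdist x S"
  have d0: "0 \<le> d" by (simp add: d_def infdist_nonneg)
  have dle: "d \<le> norm (x - s)" if "s \<in> S" for s
    using infdist_le[OF that, of x] by (simp add: d_def dist_norm)
  have "\<exists>s\<in>S. norm (x - s) < d + 1 / real (Suc n)" for n
  proof -
    have "infdist x S < d + 1 / real (Suc n)" by (simp add: d_def)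
    then obtain s where "s \<in> S" "dist x s < d + 1 / real (Suc n)"
      using infdist_notempty[OF ne, of x] cINF_less_iff[of S "dist x"] ne by (auto simp: bdd_below_def intro: zero_le_dist)
    then show ?thesis by (auto simp: dist_norm)
  qed
  then obtain s where sS: "\<And>n. s n \<in> S" and s: "\<And>n. norm (x - s n) < d + 1 / real (Suc n)"
    by metis
  have lim: "(\<lambda>n. norm (x - s n)) \<longlonglongrightarrow> d"
  proof (rule tendsto_sandwich[of "\<lambda>_. d" _ _ "\<lambda>n. d + 1 / real (Suc n)"])
    show "(\<lambda>n. d + 1 / real (Suc n)) \<longlonglongrightarrow> d"
      using tendsto_add[OF tendsto_const LIMSEQ_inverse_real_of_nat, of d] by (simp add: inverse_eq_divide)
  qed (use dle sS less_imp_le[OF s] in auto)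
  then have lim2: "(\<lambda>n. (norm (x - s n))\<^sup>2) \<longlonglongrightarrow> d\<^sup>2" by (rule tendsto_power)
  have "Cauchy s"
  proof (rule metric_CauchyI)
    fix e :: real assume e: "0 < e"
    have "eventually (\<lambda>n. (norm (x - s n))\<^sup>2 < d\<^sup>2 + e\<^sup>2 / 4) sequentially"
      by (rule order_tendstoD(2)[OF lim2]) (use e in auto)
    then obtain M where M: "\<And>n. n \<ge> M \<Longrightarrow> (norm (x - s n))\<^sup>2 < d\<^sup>2 + e\<^sup>2 / 4"
      by (auto simp: eventually_sequentially)
    have "dist (s m) (s n) < e" if "m \<ge> M" "n \<ge> M" for m n
    proof -
      have "(1/2) *\<^sub>R (s m + s n) \<in> S" using S(1) sS by (simp add: subspace_add subspace_scale)
      then have "d\<^sup>2 \<le> (norm (x - (1/2) *\<^sub>R (s m + s n)))\<^sup>2" using dle d0 by (simp add: power_mono)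
      then have "(norm (s m - s n))\<^sup>2 < e\<^sup>2"
        using M[OF that(1)] M[OF that(2)] norm_minus_sq_parallelogram[of "s m" "s n" x] by linarith
      then show ?thesis using e by (simp add: dist_norm power2_less_imp_less)
    qed
    then show "\<exists>M. \<forall>m\<ge>M. \<forall>n\<ge>M. dist (s m) (s n) < e" by blast
  qed
  then obtain p where p: "s \<longlonglongrightarrow> p" by (auto simp: Cauchy_convergent_iff convergent_def)
  have pS: "p \<in> S" using S(2) sS p closed_sequentially by blast
  have np: "norm (x - p) = d"
    by (rule LIMSEQ_unique[OF _ lim]) (intro tendsto_intros p)
  show ?thesis
  proof (rule that[OF pS])
    fix v assume v: "v \<in> S"
    show "inner (x - p) v = 0"
    proof (rule orthogonal_if_minimizing)
      fix r
      have "p + r *\<^sub>R v \<in> S" using S(1) pS v by (simp add: subspace_add subspace_scale)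
      from dle[OF this] show "norm (x - p) \<le> norm (x - p - r *\<^sub>R v)"
        by (simp add: np algebra_simps)
    qed
  qed
qed

lemma subspace_closure:
  fixes S :: "'a::real_normed_vector set"
  assumes S: "subspace S"
  shows "subspace (closure S)"
proof (rule subspaceI)
  show "0 \<in> closure S" using subspace_0[OF S] closure_subset by blast
next
  fix x y assume "x \<in> closure S" "y \<in> closure S"
  then obtain f g where "\<And>n. f n \<in> S" "f \<longlonglongrightarrow> x" "\<And>n. g n \<in> S" "g \<longlonglongrightarrow> y"
    unfolding closure_sequential by blast
  then show "x + y \<in> closure S"
    unfolding closure_sequential
    by (intro exI[of _ "\<lambda>n. f n + g n"]) (auto intro: subspace_add[OF S] tendsto_add)
next
  fix c x assume "x \<in> closure S"
  then obtain f where "\<And>n. f n \<in> S" "f \<longlonglongrightarrow> x" unfolding closure_sequential by blast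
  then show "c *\<^sub>R x \<in> closure S"
    unfolding closure_sequential
    by (intro exI[of _ "\<lambda>n. c *\<^sub>R f n"]) (auto intro: subspace_scale[OF S] tendsto_scaleR)
qed

section \<open>The exponential of a bounded operator\<close>

text \<open>
  The orbit \<open>e\<^sup>t\<^sup>B x\<close> of a vector. A series of vectors, rather than of operators, avoids a normed algebra of
  operators, whose unit would not have norm one in the trivial space.
\<close>

definition op_exp :: "('a::banach \<Rightarrow> 'a) \<Rightarrow> real \<Rightarrow> 'a \<Rightarrow> 'a"
  where "op_exp B t x = (\<Sum>n. (t ^ n / fact n) *\<^sub>R (B ^^ n) x)"

lemma op_exp_0 [simp]: "op_exp B 0 x = x"
proof -
  have "(\<Sum>n. (0 ^ n / fact n) *\<^sub>R (B ^^ n) x) = (\<Sum>n\<in>{0}. (0 ^ n / fact n :: real) *\<^sub>R (B ^^ n) x)"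
    by (rule suminf_finite) auto
  then show ?thesis by (simp add: op_exp_def)
qed

lemma op_exp_uniform_limit:
  fixes B :: "'a::banach \<Rightarrow> 'a"
  assumes "bounded_linear B"
  shows "uniform_limit {-T..T} (\<lambda>n t. \<Sum>i<n. (t ^ i / fact i) *\<^sub>R (B ^^ i) x) (\<lambda>t. op_exp B t x) sequentially"
proof -
  obtain K where K: "K > 0" "\<And>v. norm (B v) \<le> norm v * K"
    using bounded_linear.pos_bounded[OF assms] by auto
  have pow: "norm ((B ^^ i) x) \<le> K ^ i * norm x" for i
  proof (induction i)
    case (Suc i)
    have "norm ((B ^^ Suc i) x) \<le> norm ((B ^^ i) x) * K" using K(2) by simp
    also have "\<dots> \<le> (K ^ i * norm x) * K" using Suc K(1) by (intro mult_right_mono) auto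
    finally show ?case by (simp add: algebra_simps)
  qed simp
  show ?thesis unfolding op_exp_def
  proof (rule Weierstrass_m_test)
    fix n t assume "t \<in> {-T..T}"
    then have "\<bar>t\<bar> ^ n \<le> \<bar>T\<bar> ^ n" by (intro power_mono) auto
    then have "\<bar>t\<bar> ^ n * norm ((B ^^ n) x) \<le> \<bar>T\<bar> ^ n * (K ^ n * norm x)"
      by (intro mult_mono pow) auto
    then show "norm ((t ^ n / fact n) *\<^sub>R (B ^^ n) x) \<le> (inverse (fact n) * (\<bar>T\<bar> * K) ^ n) * norm x"
      by (simp add: power_abs power_mult_distrib field_simps)
  next
    show "summable (\<lambda>n. inverse (fact n) * (\<bar>T\<bar> * K) ^ n * norm x)"
      by (intro summable_mult2 summable_exp)
  qed
qed

lemma op_exp_sums: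
  assumes "bounded_linear B"
  shows "(\<lambda>n. (t ^ n / fact n) *\<^sub>R (B ^^ n) x) sums op_exp B t x"
  unfolding sums_def
  by (rule tendsto_uniform_limitI[OF op_exp_uniform_limit[OF assms, where T = "\<bar>t\<bar>"]]) auto

lemma op_exp_commute:
  assumes B: "bounded_linear B" and C: "bounded_linear C" and comm: "\<And>v. C (B v) = B (C v)"
  shows "C (op_exp B t x) = op_exp B t (C x)"
proof -
  have "C ((B ^^ n) x) = (B ^^ n) (C x)" for n
    by (induction n) (simp_all add: comm)
  then have "(\<lambda>n. C ((t ^ n / fact n) *\<^sub>R (B ^^ n) x)) = (\<lambda>n. (t ^ n / fact n) *\<^sub>R (B ^^ n) (C x))"
    by (simp add: linear_cmul[OF bounded_linear.linear[OF C]])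
  with bounded_linear.sums[OF C op_exp_sums[OF B, of t x]]
  have "(\<lambda>n. (t ^ n / fact n) *\<^sub>R (B ^^ n) (C x)) sums C (op_exp B t x)" by simp
  from sums_unique2[OF this op_exp_sums[OF B]] show ?thesis .
qed

text \<open>
  The series is differentiated term by term on a bounded interval; the derived series is the
  exponential series at \<open>B x\<close>, shifted by one.
\<close>

lemma op_exp_has_vector_derivative:
  fixes B :: "'a::banach \<Rightarrow> 'a"
  assumes B: "bounded_linear B"
  shows "((\<lambda>t. op_exp B t x) has_vector_derivative B (op_exp B t x)) (at t)"
proof -
  define T where "T = \<bar>t\<bar> + 1"
  define f where "f n s = (s ^ n / fact n) *\<^sub>R (B ^^ n) x" for n and s :: real
  define f' where "f' n s h = h *\<^sub>R ((if n = 0 then 0 else s ^ (n - 1) / fact (n - 1)) *\<^sub>R (B ^^ n) x)"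
    for n and s h :: real
  have "\<exists>g. \<forall>s\<in>{-T..T}. (\<lambda>n. f n s) sums g s \<and> (g has_derivative (\<lambda>h. h *\<^sub>R op_exp B s (B x))) (at s within {-T..T})"
  proof (rule has_derivative_series[where f' = f'])
    fix n and s :: real
    have "((\<lambda>s. s ^ n / fact n) has_real_derivative (if n = 0 then 0 else s ^ (n - 1) / fact (n - 1))) (at s within {-T..T})"
    proof (cases n)
      case (Suc m)
      have "real (Suc m) * s ^ m / fact (Suc m) = s ^ m / fact m"
        by (simp del: of_nat_Suc)
      moreover have "((\<lambda>s. s ^ Suc m / fact (Suc m)) has_real_derivative real (Suc m) * s ^ m / fact (Suc m)) (at s within {-T..T})"
        by (rule DERIV_cdivide) (rule derivative_eq_intros refl | simp)+
      ultimately show ?thesis using Suc by simp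
    qed simp
    then show "(f n has_derivative f' n s) (at s within {-T..T})"
      unfolding f_def f'_def has_vector_derivative_def[symmetric]
      unfolding has_real_derivative_iff_has_vector_derivative
      by (rule bounded_linear.has_vector_derivative[OF bounded_linear_scaleR_left])
  next
    have S: "(\<Sum>i<n. f' i s h) = h *\<^sub>R (\<Sum>i<n - 1. (s ^ i / fact i) *\<^sub>R (B ^^ i) (B x))" for n s h
    proof (cases n)
      case (Suc m)
      have "(\<Sum>i<Suc m. f' i s h) = (\<Sum>i<m. f' (Suc i) s h)"
        by (subst sum.lessThan_Suc_shift) (simp add: f'_def)
      then show ?thesis using Suc by (simp add: f'_def scaleR_sum_right funpow_swap1)
    qed simp
    fix e :: real assume e: "e > 0"
    have "\<forall>\<^sub>F n in sequentially. \<forall>s\<in>{-T..T}. dist (\<Sum>i<n. (s ^ i / fact i) *\<^sub>R (B ^^ i) (B x)) (op_exp B s (B x)) < e"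
      by (rule uniform_limitD[OF op_exp_uniform_limit[OF B] e])
    then have "\<forall>\<^sub>F n in sequentially. \<forall>s\<in>{-T..T}. dist (\<Sum>i<n - 1. (s ^ i / fact i) *\<^sub>R (B ^^ i) (B x)) (op_exp B s (B x)) < e"
      by (rule eventually_compose_filterlim) (simp add: filterlim_minus_const_nat_at_top)
    then show "\<forall>\<^sub>F n in sequentially. \<forall>s\<in>{-T..T}. \<forall>h. norm ((\<Sum>i<n. f' i s h) - h *\<^sub>R op_exp B s (B x)) \<le> e * norm h"
    proof (rule eventually_mono, intro ballI allI)
      fix n s h
      assume *: "\<forall>s\<in>{-T..T}. dist (\<Sum>i<n - 1. (s ^ i / fact i) *\<^sub>R (B ^^ i) (B x)) (op_exp B s (B x)) < e"
        and s: "s \<in> {-T..T}"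
      have "(\<Sum>i<n. f' i s h) - h *\<^sub>R op_exp B s (B x)
        = h *\<^sub>R ((\<Sum>i<n - 1. (s ^ i / fact i) *\<^sub>R (B ^^ i) (B x)) - op_exp B s (B x))"
        unfolding S by (rule scaleR_diff_right[symmetric])
      moreover have "norm \<dots> \<le> \<bar>h\<bar> * e"
        unfolding norm_scaleR using *[rule_format, OF s] by (intro mult_left_mono) (simp_all add: dist_norm)
      ultimately show "norm ((\<Sum>i<n. f' i s h) - h *\<^sub>R op_exp B s (B x)) \<le> e * norm h"
        by (simp add: mult.commute)
    qed
  next
    show "(\<lambda>n. f n t) sums op_exp B t x" unfolding f_def by (rule op_exp_sums[OF B])
  qed (auto simp: T_def)
  then obtain g where "\<forall>s\<in>{-T..T}. (\<lambda>n. f n s) sums g s \<and>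
      (g has_derivative (\<lambda>h. h *\<^sub>R op_exp B s (B x))) (at s within {-T..T})"
    by blast
  then have g: "\<And>s. s \<in> {-T..T} \<Longrightarrow> (\<lambda>n. f n s) sums g s"
    "\<And>s. s \<in> {-T..T} \<Longrightarrow> (g has_derivative (\<lambda>h. h *\<^sub>R op_exp B s (B x))) (at s within {-T..T})"
    by blast+
  have eq: "g s = op_exp B s x" if "s \<in> {-T..T}" for s
    using sums_unique2[OF g(1)[OF that]] op_exp_sums[OF B, of s x] by (simp add: f_def)
  have t: "t \<in> {-T..T}" "t \<in> {-T<..<T}" by (auto simp: T_def)
  have "at t within {-T..T} = at t"
    by (rule at_within_interior) (use t in simp)
  then have "(g has_vector_derivative op_exp B t (B x)) (at t)"
    using g(2)[OF t(1)] by (simp add: has_vector_derivative_def)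
  then have "((\<lambda>s. op_exp B s x) has_vector_derivative op_exp B t (B x)) (at t)"
    by (rule has_vector_derivative_transform_within_open[where S = "{-T<..<T}"]) (use t eq in auto)
  then show ?thesis using op_exp_commute[OF B B] by simp
qed

section \<open>Groups generated by bounded skew operators\<close>

text \<open>
  Conservation of energy. Applied to the difference of two solutions of a linear equation with a skew right-hand
  side, it gives uniqueness.
\<close>

lemma norm_constant_if_derivative_orthogonal:
  fixes u :: "real \<Rightarrow> 'a::real_inner"
  assumes u: "\<And>t. (u has_vector_derivative u' t) (at t)"
    and orth: "\<And>t. inner (u' t) (u t) = 0"
  shows "norm (u t) = norm (u s)"
proof -
  have "((\<lambda>t. inner (u t) (u t)) has_real_derivative 0) (at t)" for t
    using bounded_bilinear.has_vector_derivative[OF bounded_bilinear_inner u u, of t] orth[of t]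
    by (simp add: has_real_derivative_iff_has_vector_derivative inner_commute)
  then have "inner (u t) (u t) = inner (u s) (u s)"
    by (intro DERIV_isconst_all) auto
  then show ?thesis by (simp add: norm_eq_sqrt_inner)
qed

locale bounded_skew =
  fixes B :: "'a::{real_inner,banach} \<Rightarrow> 'a"
  assumes bounded_linear: "bounded_linear B"
    and skew: "inner (B v) v = 0"
begin

lemma norm_op_exp [simp]: "norm (op_exp B t x) = norm x"
  using norm_constant_if_derivative_orthogonal
    [OF op_exp_has_vector_derivative[OF bounded_linear] skew, of t x 0] by simp

lemma op_exp_unique:
  assumes u: "\<And>t. (u has_vector_derivative B (u t)) (at t)"
  shows "u t = op_exp B t (u 0)"
proof -
  have "norm (u t - op_exp B t (u 0)) = norm (u 0 - op_exp B 0 (u 0))"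
  proof (rule norm_constant_if_derivative_orthogonal)
    fix t
    show "((\<lambda>t. u t - op_exp B t (u 0)) has_vector_derivative B (u t) - B (op_exp B t (u 0))) (at t)"
      by (intro derivative_intros u op_exp_has_vector_derivative bounded_linear)
    show "inner (B (u t) - B (op_exp B t (u 0))) (u t - op_exp B t (u 0)) = 0"
      using skew[of "u t - op_exp B t (u 0)"] linear_diff[OF bounded_linear.linear[OF bounded_linear]] by simp
  qed
  then show ?thesis by simp
qed

lemma linear_op_exp: "linear (op_exp B t)"
proof
  note d = op_exp_has_vector_derivative[OF bounded_linear]
    and lin = bounded_linear.linear[OF bounded_linear]
  fix x y :: 'a and c :: real
  have "((\<lambda>t. op_exp B t x + op_exp B t y) has_vector_derivative B (op_exp B t x + op_exp B t y)) (at t)" for t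
    unfolding linear_add[OF lin] by (intro derivative_intros d)
  from op_exp_unique[OF this, of t] show "op_exp B t (x + y) = op_exp B t x + op_exp B t y" by simp
  have "((\<lambda>t. c *\<^sub>R op_exp B t x) has_vector_derivative B (c *\<^sub>R op_exp B t x)) (at t)" for t
    unfolding linear_cmul[OF lin]
    by (rule bounded_linear.has_vector_derivative[OF bounded_linear_scaleR_right d])
  from op_exp_unique[OF this, of t] show "op_exp B t (c *\<^sub>R x) = c *\<^sub>R op_exp B t x" by simp
qed

lemma op_exp_add: "op_exp B (s + t) x = op_exp B s (op_exp B t x)"
proof -
  have "((\<lambda>s. op_exp B (s + t) x) has_vector_derivative B (op_exp B (s + t) x)) (at s)" for s
    using vector_diff_chain_at[of "\<lambda>s. s + t" 1 s "\<lambda>s. op_exp B s x" "B (op_exp B (s + t) x)"]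
      op_exp_has_vector_derivative[OF bounded_linear, of x "s + t"]
    by (simp add: o_def has_vector_derivative_add_const)
  from op_exp_unique[OF this, of s] show ?thesis by simp
qed

end

text \<open>
  Continuous dependence of the orbit on the generator. For the difference \<open>d\<close> of the two orbits, skewness of
  \<open>B\<close> leaves only \<open>(B - C)\<close> applied to the orbit of \<open>C\<close> in the derivative of the square of \<open>norm d\<close>, and by
  commutativity this vector has the constant norm of \<open>B x - C x\<close>. The crude bound \<open>norm d \<le> 2 norm x\<close> for the
  other factor makes a Gronwall argument unnecessary; a square root of the difference of the generators
  is good enough for a Cauchy sequence.
\<close>

lemma op_exp_diff_bound:
  assumes "bounded_skew B" "bounded_skew C" and comm: "\<And>v. B (C v) = C (B v)"
  shows "(norm (op_exp B t x - op_exp C t x))\<^sup>2 \<le> 4 * \<bar>t\<bar> * norm x * norm (B x - C x)"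
proof -
  interpret B: bounded_skew B by fact
  interpret C: bounded_skew C by fact
  define u v where "u t = op_exp B t x" and "v t = op_exp C t x" for t
  define \<phi>' where "\<phi>' t = 2 * inner (B (u t) - C (v t)) (u t - v t)" for t
  have der: "((\<lambda>t. inner (u t - v t) (u t - v t)) has_real_derivative \<phi>' t) (at t)" for t
  proof -
    have "((\<lambda>t. u t - v t) has_vector_derivative B (u t) - C (v t)) (at t)"
      unfolding u_def v_def
      by (intro derivative_intros op_exp_has_vector_derivative B.bounded_linear C.bounded_linear)
    from bounded_bilinear.has_vector_derivative[OF bounded_bilinear_inner this this]
    show ?thesis unfolding \<phi>'_def
      by (simp add: has_real_derivative_iff_has_vector_derivative inner_commute)
  qed
  have bound: "norm (\<phi>' t) \<le> 4 * norm x * norm (B x - C x)" for t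
  proof -
    have "B (v t) - C (v t) = op_exp C t (B x - C x)"
      unfolding v_def linear_diff[OF C.linear_op_exp]
      using op_exp_commute[OF C.bounded_linear B.bounded_linear] op_exp_commute[OF C.bounded_linear C.bounded_linear] comm
      by simp
    then have n: "norm (B (v t) - C (v t)) = norm (B x - C x)" by simp
    have "\<phi>' t = 2 * inner (B (u t - v t) + (B (v t) - C (v t))) (u t - v t)"
      by (simp add: \<phi>'_def linear_diff[OF bounded_linear.linear[OF B.bounded_linear]])
    also have "\<dots> = 2 * inner (B (v t) - C (v t)) (u t - v t)"
      unfolding inner_add_left B.skew by simp
    also have "norm \<dots> \<le> 2 * (norm (B x - C x) * norm (u t - v t))"
      using Cauchy_Schwarz_ineq2[of "B (v t) - C (v t)" "u t - v t"] n by (simp add: abs_mult)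
    also have "\<dots> \<le> 2 * (norm (B x - C x) * (2 * norm x))"
      using norm_triangle_ineq4[of "u t" "v t"] by (intro mult_left_mono) (simp_all add: u_def v_def)
    finally show ?thesis by (simp add: algebra_simps)
  qed
  have "norm (inner (u t - v t) (u t - v t) - inner (u 0 - v 0) (u 0 - v 0)) \<le> 4 * norm x * norm (B x - C x) * norm (t - 0)"
    by (rule field_differentiable_bound[of UNIV _ \<phi>']) (use der bound in auto)
  then show ?thesis by (simp add: u_def v_def power2_norm_eq_inner algebra_simps)
qed

section \<open>Resolvents and Yosida approximations of a skew-adjoint operator\<close>

text \<open>
  The operator equals minus its adjoint, including the domains. Linearity of the domain and of the operator,
  closedness of the graph and skew symmetry all follow from this description of the graph.
\<close>

locale skew_adjoint =
  fixes D :: "'a::{real_inner,banach} set" and G :: "'a \<Rightarrow> 'a"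
  assumes dense: "closure D = UNIV"
    and graph: "(\<forall>u\<in>D. inner (G u) v = - inner u w) \<longleftrightarrow> v \<in> D \<and> w = G v"
begin

lemma skew_symmetric: "u \<in> D \<Longrightarrow> v \<in> D \<Longrightarrow> inner (G u) v = - inner u (G v)"
  using graph[of v "G v"] by blast

lemma skew: "u \<in> D \<Longrightarrow> inner (G u) u = 0"
  using skew_symmetric[of u u] by (simp add: inner_commute)

lemma add: "u \<in> D \<Longrightarrow> v \<in> D \<Longrightarrow> u + v \<in> D \<and> G (u + v) = G u + G v"
  using graph[of "u + v" "G u + G v"] by (simp add: inner_add_right skew_symmetric)

lemma scale: "u \<in> D \<Longrightarrow> c *\<^sub>R u \<in> D \<and> G (c *\<^sub>R u) = c *\<^sub>R G u"
  using graph[of "c *\<^sub>R u" "c *\<^sub>R G u"] by (simp add: skew_symmetric)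

lemma diff: "u \<in> D \<Longrightarrow> v \<in> D \<Longrightarrow> u - v \<in> D \<and> G (u - v) = G u - G v"
  using add[of u "(-1) *\<^sub>R v"] scale[of v "-1"] by simp

lemma subspace_domain: "subspace D"
proof (rule subspaceI)
  show "0 \<in> D" using graph[of 0 0] by simp
qed (use add scale in auto)

lemma graph_closed:
  assumes "\<And>n. x n \<in> D" "x \<longlonglongrightarrow> v" "(\<lambda>n. G (x n)) \<longlonglongrightarrow> w"
  shows "v \<in> D" "G v = w"
proof -
  have "inner (G u) v = - inner u w" if u: "u \<in> D" for u
  proof (rule LIMSEQ_unique)
    show "(\<lambda>n. inner (G u) (x n)) \<longlonglongrightarrow> inner (G u) v" by (intro tendsto_intros assms)
    have "inner (G u) (x n) = - inner u (G (x n))" for n using skew_symmetric u assms(1) by simp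
    then show "(\<lambda>n. inner (G u) (x n)) \<longlonglongrightarrow> - inner u w"
      by (simp only:) (intro tendsto_intros assms)
  qed
  then show "v \<in> D" "G v = w" using graph[of v w] by auto
qed

text \<open>
  Pythagoras, as \<open>G u\<close> is orthogonal to \<open>u\<close>. It makes \<open>1 - l G\<close> injective with closed range and its inverse
  a contraction, for nonzero \<open>l\<close> of either sign.
\<close>

lemma norm_minus_scaled_generator_eq:
  assumes "u \<in> D"
  shows "(norm (u - l *\<^sub>R G u))\<^sup>2 = (norm u)\<^sup>2 + l\<^sup>2 * (norm (G u))\<^sup>2"
proof -
  have "(norm (u - l *\<^sub>R G u))\<^sup>2 = inner u u - 2 * l * inner (G u) u + l * (l * inner (G u) (G u))"
    unfolding power2_norm_eq_inner
    by (simp only: inner_diff_left inner_diff_right inner_commute[of u "G u"] inner_scaleR_left inner_scaleR_right)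
      (simp add: algebra_simps)
  then show ?thesis using skew[OF assms] unfolding power2_norm_eq_inner by (simp add: power2_eq_square)
qed

lemma norm_le_norm_minus_scaled_generator: "u \<in> D \<Longrightarrow> norm u \<le> norm (u - l *\<^sub>R G u)"
  by (rule power2_le_imp_le) (simp_all add: norm_minus_scaled_generator_eq)

lemma closed_range_minus_scaled_generator:
  assumes l: "l \<noteq> 0"
  shows "closed ((\<lambda>v. v - l *\<^sub>R G v) ` D)"
  unfolding closed_sequential_limits
proof (intro allI impI, elim conjE)
  fix r z assume "\<forall>n. r n \<in> (\<lambda>v. v - l *\<^sub>R G v) ` D" and r: "r \<longlonglongrightarrow> z"
  then have "\<forall>n. \<exists>v\<in>D. r n = v - l *\<^sub>R G v" by auto
  then obtain v where vD: "\<And>n. v n \<in> D" and v: "\<And>n. r n = v n - l *\<^sub>R G (v n)" by metis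
  have le: "dist (v m) (v n) \<le> dist (r m) (r n)" for m n
    using norm_le_norm_minus_scaled_generator[of "v m - v n" l] diff[OF vD vD, of m n]
    by (simp add: dist_norm v algebra_simps)
  have "Cauchy r" using r by (rule LIMSEQ_imp_Cauchy)
  then have "Cauchy v" unfolding Cauchy_def using le by (meson le_less_trans)
  then obtain w where w: "v \<longlonglongrightarrow> w" by (auto simp: Cauchy_convergent_iff convergent_def)
  have Gv: "G (v n) = (1 / l) *\<^sub>R (v n - r n)" for n using l by (simp add: v)
  have "(\<lambda>n. G (v n)) \<longlonglongrightarrow> (1 / l) *\<^sub>R (w - z)"
    unfolding Gv by (intro tendsto_intros w r)
  from graph_closed[OF vD w this] have "w \<in> D" "z = w - l *\<^sub>R G w" using l by auto
  then show "z \<in> (\<lambda>v. v - l *\<^sub>R G v) ` D" by blast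
qed

text \<open>
  A vector \<open>z\<close> orthogonal to the range satisfies \<open>\<langle>G u, z\<rangle> = \<langle>u, z\<rangle> / l\<close> for all \<open>u\<close> in the domain, so
  skew-adjointness makes it an eigenvector of \<open>G\<close> with the real eigenvalue \<open>- 1 / l\<close>; this is
  impossible for nonzero \<open>z\<close>, since \<open>G z\<close> is orthogonal to \<open>z\<close>.
\<close>

lemma range_minus_scaled_generator:
  assumes l: "l \<noteq> 0"
  shows "(\<lambda>v. v - l *\<^sub>R G v) ` D = UNIV"
proof -
  let ?R = "(\<lambda>v. v - l *\<^sub>R G v) ` D"
  have sub: "subspace ?R"
  proof (rule subspaceI)
    show "0 \<in> ?R" using subspace_0[OF subspace_domain] scale[of 0 0] by (auto intro!: image_eqI[of _ _ 0])
  next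
    fix x y assume "x \<in> ?R" "y \<in> ?R"
    then obtain u v where uv: "u \<in> D" "v \<in> D" and xy: "x = u - l *\<^sub>R G u" "y = v - l *\<^sub>R G v" by auto
    have "x + y = (u + v) - l *\<^sub>R G (u + v)" by (simp add: xy add uv algebra_simps)
    then show "x + y \<in> ?R" using add uv by blast
  next
    fix c x assume "x \<in> ?R"
    then obtain u where u: "u \<in> D" and x: "x = u - l *\<^sub>R G u" by auto
    have "c *\<^sub>R x = c *\<^sub>R u - l *\<^sub>R G (c *\<^sub>R u)" by (simp add: x scale u algebra_simps)
    then show "c *\<^sub>R x \<in> ?R" using scale u by blast
  qed
  have "x \<in> ?R" for x
  proof -
    obtain p where p: "p \<in> ?R" and orth: "\<And>s. s \<in> ?R \<Longrightarrow> inner (x - p) s = 0"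
      using closed_subspace_projection[OF sub closed_range_minus_scaled_generator[OF l], of x] by blast
    define z where "z = x - p"
    have "inner (G u) z = - inner u (- (1 / l) *\<^sub>R z)" if "u \<in> D" for u
    proof -
      have "inner z (u - l *\<^sub>R G u) = 0" unfolding z_def by (rule orth) (use that in auto)
      then show ?thesis using l by (simp add: inner_diff_right inner_commute field_simps)
    qed
    then have "z \<in> D" "G z = - (1 / l) *\<^sub>R z" using graph[of z "- (1 / l) *\<^sub>R z"] by auto
    with skew[of z] have "z = 0" using l by auto
    then show ?thesis using p by (simp add: z_def)
  qed
  then show ?thesis by blast
qed

text \<open>
  In the scaling \<open>(1 - l G)\<^sup>-\<^sup>1\<close> the resolvent is a contraction and tends to the identity as \<open>l\<close> tends to zero.
\<close>

definition resolvent :: "real \<Rightarrow> 'a \<Rightarrow> 'a" where "resolvent l = inv_into D (\<lambda>v. v - l *\<^sub>R G v)"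

lemma resolvent_eqI:
  assumes "v \<in> D" "v - l *\<^sub>R G v = x"
  shows "resolvent l x = v"
proof -
  have "inj_on (\<lambda>v. v - l *\<^sub>R G v) D"
  proof (rule inj_onI)
    fix u v assume uv: "u \<in> D" "v \<in> D" "u - l *\<^sub>R G u = v - l *\<^sub>R G v"
    have "(u - v) - l *\<^sub>R G (u - v) = (u - l *\<^sub>R G u) - (v - l *\<^sub>R G v)"
      by (simp add: diff uv(1,2) algebra_simps)
    then have "(u - v) - l *\<^sub>R G (u - v) = 0" using uv(3) by simp
    then have "norm (u - v) \<le> 0" using norm_le_norm_minus_scaled_generator[of "u - v" l] diff[OF uv(1,2)] by (simp only: norm_zero)
    then show "u = v" by simp
  qed
  then show ?thesis using assms inv_into_f_f by (fastforce simp: resolvent_def)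
qed

lemma resolvent_in_domain [simp]: "l \<noteq> 0 \<Longrightarrow> resolvent l x \<in> D"
  unfolding resolvent_def using range_minus_scaled_generator by (intro inv_into_into) auto

lemma resolvent_eq: "l \<noteq> 0 \<Longrightarrow> resolvent l x - l *\<^sub>R G (resolvent l x) = x"
  unfolding resolvent_def using range_minus_scaled_generator by (intro f_inv_into_f[of x "\<lambda>v. v - l *\<^sub>R G v"]) auto

lemma norm_resolvent_le: "l \<noteq> 0 \<Longrightarrow> norm (resolvent l x) \<le> norm x"
  using norm_le_norm_minus_scaled_generator[of "resolvent l x" l] resolvent_eq[of l x] by simp

lemma bounded_linear_resolvent:
  assumes l: "l \<noteq> 0"
  shows "bounded_linear (resolvent l)"
proof (rule bounded_linear_intro[where K = 1])
  fix x y :: 'a and c :: real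
  show "resolvent l (x + y) = resolvent l x + resolvent l y"
  proof (rule resolvent_eqI)
    have "resolvent l x + resolvent l y - l *\<^sub>R G (resolvent l x + resolvent l y) = (resolvent l x - l *\<^sub>R G (resolvent l x)) + (resolvent l y - l *\<^sub>R G (resolvent l y))"
      by (simp add: add l algebra_simps)
    then show "resolvent l x + resolvent l y - l *\<^sub>R G (resolvent l x + resolvent l y) = x + y" by (simp only: resolvent_eq[OF l])
  qed (use add l in auto)
  show "resolvent l (c *\<^sub>R x) = c *\<^sub>R resolvent l x"
  proof (rule resolvent_eqI)
    have "c *\<^sub>R resolvent l x - l *\<^sub>R G (c *\<^sub>R resolvent l x) = c *\<^sub>R (resolvent l x - l *\<^sub>R G (resolvent l x))"
      by (simp add: scale l algebra_simps)
    then show "c *\<^sub>R resolvent l x - l *\<^sub>R G (c *\<^sub>R resolvent l x) = c *\<^sub>R x" by (simp only: resolvent_eq[OF l])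
  qed (use scale l in auto)
  show "norm (resolvent l x) \<le> norm x * 1" using norm_resolvent_le[OF l] by simp
qed

lemma generator_resolvent: "l \<noteq> 0 \<Longrightarrow> G (resolvent l x) = (1 / l) *\<^sub>R (resolvent l x - x)"
proof -
  assume l: "l \<noteq> 0"
  have "resolvent l x - x = l *\<^sub>R G (resolvent l x)" using resolvent_eq[OF l, of x] by (simp add: algebra_simps)
  then show ?thesis using l by simp
qed

lemma resolvent_generator_commute:
  assumes l: "l \<noteq> 0" and x: "x \<in> D"
  shows "resolvent l (G x) = G (resolvent l x)"
proof (rule resolvent_eqI)
  have d: "resolvent l x - x \<in> D" "G (resolvent l x - x) = G (resolvent l x) - G x" using diff[OF resolvent_in_domain[OF l] x] by auto
  show "G (resolvent l x) \<in> D" unfolding generator_resolvent[OF l] using scale[OF d(1)] by blast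
  have "G (G (resolvent l x)) = G ((1 / l) *\<^sub>R (resolvent l x - x))" by (simp only: generator_resolvent[OF l])
  also have "\<dots> = (1 / l) *\<^sub>R (G (resolvent l x) - G x)" using scale[OF d(1)] d(2) by simp
  finally have "G (G (resolvent l x)) = (1 / l) *\<^sub>R (G (resolvent l x) - G x)" .
  then show "G (resolvent l x) - l *\<^sub>R G (G (resolvent l x)) = G x" using l by simp
qed

lemma resolvents_commute:
  assumes l: "l \<noteq> 0" and m: "m \<noteq> 0"
  shows "resolvent l (resolvent m x) = resolvent m (resolvent l x)"
proof (rule resolvent_eqI)
  note lin = bounded_linear.linear[OF bounded_linear_resolvent[OF m]]
  have "resolvent m (resolvent l x) - l *\<^sub>R G (resolvent m (resolvent l x)) = resolvent m (resolvent l x - l *\<^sub>R G (resolvent l x))"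
    using resolvent_generator_commute[OF m resolvent_in_domain[OF l]] by (simp add: linear_diff[OF lin] linear_cmul[OF lin])
  then show "resolvent m (resolvent l x) - l *\<^sub>R G (resolvent m (resolvent l x)) = resolvent m x" by (simp add: resolvent_eq[OF l])
qed (use m in simp)

lemma resolvent_adjoint:
  assumes l: "l \<noteq> 0"
  shows "inner (resolvent l x) y = inner x (resolvent (- l) y)"
proof -
  have "inner (resolvent l x) (resolvent (- l) y - (- l) *\<^sub>R G (resolvent (- l) y)) = inner (resolvent l x - l *\<^sub>R G (resolvent l x)) (resolvent (- l) y)"
    using skew_symmetric[of "resolvent l x" "resolvent (- l) y"] l by (simp add: inner_diff inner_add_right)
  then show ?thesis using resolvent_eq[of l x] resolvent_eq[of "- l" y] l by simp
qed

text \<open>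
  On the domain the difference is \<open>l\<close> times a vector bounded by the norm of \<open>G x\<close>; contractivity and density
  give the general case.
\<close>

lemma resolvent_tendsto:
  assumes l: "l \<longlonglongrightarrow> 0" and l0: "\<And>n. l n \<noteq> 0"
  shows "(\<lambda>n. resolvent (l n) x) \<longlonglongrightarrow> x"
proof (rule LIMSEQ_I)
  fix e :: real assume e: "0 < e"
  obtain v where v: "v \<in> D" "dist v x < e / 3"
    using dense closure_approachable[of x D] e by (metis UNIV_I divide_pos_pos zero_less_numeral)
  have "(\<lambda>n. \<bar>l n\<bar> * norm (G v)) \<longlonglongrightarrow> \<bar>0\<bar> * norm (G v)" by (intro tendsto_intros l)
  then have "\<forall>\<^sub>F n in sequentially. \<bar>l n\<bar> * norm (G v) < e / 3"
    by (rule order_tendstoD) (use e in auto)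
  then obtain M where M: "\<And>n. n \<ge> M \<Longrightarrow> \<bar>l n\<bar> * norm (G v) < e / 3" by (auto simp: eventually_sequentially)
  have "norm (resolvent (l n) x - x) < e" if n: "n \<ge> M" for n
  proof -
    note lin = bounded_linear.linear[OF bounded_linear_resolvent[OF l0[of n]]]
    have "resolvent (l n) v - v = l n *\<^sub>R resolvent (l n) (G v)"
      using resolvent_eq[OF l0, of n v] resolvent_generator_commute[OF l0 v(1), of n] by (simp add: algebra_simps)
    then have "norm (resolvent (l n) v - v) \<le> \<bar>l n\<bar> * norm (G v)" by (simp add: norm_resolvent_le[OF l0] mult_left_mono)
    then have 1: "norm (resolvent (l n) v - v) < e / 3" using M[OF n] by simp
    have 2: "norm (resolvent (l n) (x - v)) < e / 3" using norm_resolvent_le[OF l0, of n "x - v"] v(2) by (simp add: dist_norm norm_minus_commute)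
    have "resolvent (l n) x - x = resolvent (l n) (x - v) + (resolvent (l n) v - v) + (v - x)" by (simp add: linear_diff[OF lin])
    then have "norm (resolvent (l n) x - x) \<le> norm (resolvent (l n) (x - v)) + norm (resolvent (l n) v - v) + norm (v - x)"
      by (metis norm_triangle_ineq norm_triangle_mono order_refl)
    then show ?thesis using 1 2 v(2) by (simp add: dist_norm)
  qed
  then show "\<exists>M. \<forall>n\<ge>M. norm (resolvent (l n) x - x) < e" by blast
qed

text \<open>
  The choice \<open>(resolvent l - resolvent (- l)) / (2 l)\<close> is the average of the Yosida approximations
  \<open>G (1 - l G)\<^sup>-\<^sup>1\<close> and \<open>G (1 + l G)\<^sup>-\<^sup>1\<close>. One of them alone is not skew, and its exponential is
  contractive in one direction of time only; the average is skew, so its exponential is isometric for all times.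
\<close>

definition yosida :: "nat \<Rightarrow> 'a \<Rightarrow> 'a"
  where "yosida n x = (let l = inverse (real (Suc n)) in (1 / (2 * l)) *\<^sub>R (resolvent l x - resolvent (- l) x))"

lemma bounded_skew_yosida: "bounded_skew (yosida n)"
proof (rule bounded_skew.intro)
  define l where "l = inverse (real (Suc n))"
  have l: "l \<noteq> 0" "- l \<noteq> 0" by (auto simp: l_def)
  have yos: "yosida n = (\<lambda>x. (1 / (2 * l)) *\<^sub>R (resolvent l x - resolvent (- l) x))"
    by (simp add: yosida_def l_def Let_def fun_eq_iff)
  show "bounded_linear (yosida n)" unfolding yos
    by (intro bounded_linear_const_scaleR bounded_linear_sub bounded_linear_resolvent l)
  fix v show "inner (yosida n v) v = 0" unfolding yos
    using resolvent_adjoint[OF l(1), of v v] by (simp add: inner_diff_left inner_commute[of v])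
qed

lemma yosida_commute: "yosida n (yosida m x) = yosida m (yosida n x)"
proof -
  define k l where "k = inverse (real (Suc n))" and "l = inverse (real (Suc m))"
  have kl: "k \<noteq> 0" "- k \<noteq> 0" "l \<noteq> 0" "- l \<noteq> 0" by (auto simp: k_def l_def)
  have yos: "yosida n x = (1 / (2 * k)) *\<^sub>R (resolvent k x - resolvent (- k) x)" "yosida m x = (1 / (2 * l)) *\<^sub>R (resolvent l x - resolvent (- l) x)" for x
    by (simp_all add: yosida_def k_def l_def Let_def)
  show ?thesis unfolding yos
    by (simp add: linear_diff[OF bounded_linear.linear[OF bounded_linear_resolvent]]
      linear_cmul[OF bounded_linear.linear[OF bounded_linear_resolvent]] kl scaleR_diff_right
      resolvents_commute[of l k] resolvents_commute[of "- l" k] resolvents_commute[of l "- k"] resolvents_commute[of "- l" "- k"] mult.commute)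
qed

lemma yosida_tendsto:
  assumes x: "x \<in> D"
  shows "(\<lambda>n. yosida n x) \<longlonglongrightarrow> G x"
proof -
  have eq: "yosida n x = (1 / 2) *\<^sub>R (resolvent (inverse (real (Suc n))) (G x) + resolvent (- inverse (real (Suc n))) (G x))" for n
  proof -
    define l where "l = inverse (real (Suc n))"
    have l: "l \<noteq> 0" "- l \<noteq> 0" by (auto simp: l_def)
    have "resolvent l x = x + l *\<^sub>R resolvent l (G x)" "resolvent (- l) x = x - l *\<^sub>R resolvent (- l) (G x)"
      using resolvent_eq[OF l(1), of x] resolvent_eq[OF l(2), of x] resolvent_generator_commute[OF l(1) x] resolvent_generator_commute[OF l(2) x]
      by (simp_all add: algebra_simps)
    then have "resolvent l x - resolvent (- l) x = l *\<^sub>R (resolvent l (G x) + resolvent (- l) (G x))" by (simp add: algebra_simps)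
    then show ?thesis using l unfolding yosida_def l_def[symmetric] Let_def by simp
  qed
  have 0: "(\<lambda>n. inverse (real (Suc n))) \<longlonglongrightarrow> 0" by (rule LIMSEQ_inverse_real_of_nat)
  have lim_neg: "(\<lambda>n. - inverse (real (Suc n))) \<longlonglongrightarrow> 0"
    by (rule tendsto_minus[OF 0, unfolded minus_zero])
  have "(\<lambda>n. yosida n x) \<longlonglongrightarrow> (1 / 2) *\<^sub>R (G x + G x)" unfolding eq
    by (intro tendsto_intros resolvent_tendsto 0 lim_neg) auto
  then show ?thesis by (simp add: scaleR_2[symmetric])
qed

end

section \<open>The group generated by a skew-adjoint operator\<close>

locale orthogonal_group =
  fixes U :: "real \<Rightarrow> 'a::{real_inner,banach} \<Rightarrow> 'a"
  assumes linear: "linear (U t)"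
    and isometric [simp]: "norm (U t x) = norm x"
    and U_0 [simp]: "U 0 x = x"
    and U_add: "U (s + t) x = U s (U t x)"
    and continuous: "continuous_on UNIV (\<lambda>t. U t x)"
begin

lemma bounded_linear: "bounded_linear (U t)"
  by (rule bounded_linear_intro[where K = 1]) (simp_all add: linear_add linear_cmul linear)

lemma inner_eq: "inner (U t x) (U t y) = inner x y"
proof -
  have "(norm (U t (x + y)))\<^sup>2 = (norm (x + y))\<^sup>2" by simp
  then have "(norm (U t x + U t y))\<^sup>2 = (norm (x + y))\<^sup>2" by (simp only: linear_add[OF linear])
  moreover have "(norm (U t x))\<^sup>2 = (norm x)\<^sup>2" "(norm (U t y))\<^sup>2 = (norm y)\<^sup>2" by simp_all
  ultimately show ?thesis unfolding power2_norm_eq_inner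
    by (simp add: inner_add inner_commute)
qed

lemma U_minus_cancel: "U (- t) (U t x) = x" "U t (U (- t) x) = x"
  using U_add[of "- t" t x] U_add[of t "- t" x] by simp_all

lemma inner_adjoint: "inner (U t x) y = inner x (U (- t) y)"
  using inner_eq[of t x "U (- t) y"] by (simp add: U_minus_cancel)

end

text \<open>
  The equivalence fixes the domain of the generator: the orbit is differentiable at zero only for vectors in
  the domain.
\<close>

locale generated_group = skew_adjoint D G + orthogonal_group U
  for D :: "'a::{real_inner,banach} set" and G U +
  assumes generator: "((\<lambda>t. U t x) has_vector_derivative z) (at 0) \<longleftrightarrow> x \<in> D \<and> z = G x"
begin

lemma has_vector_derivative_at_shift:
  assumes "((\<lambda>t. U t x) has_vector_derivative z) (at 0)"
  shows "((\<lambda>t. U t x) has_vector_derivative U t z) (at t)"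
proof -
  have "((\<lambda>s. U t (U s x)) has_vector_derivative U t z) (at 0)"
    by (rule bounded_linear.has_vector_derivative[OF bounded_linear assms])
  then have "((\<lambda>s. U (t + s) x) has_vector_derivative U t z) (at 0)" by (simp add: U_add)
  then have "(((\<lambda>s. U (t + s) x) \<circ> (\<lambda>s. s - t)) has_vector_derivative (1 *\<^sub>R U t z)) (at t)"
    by (intro vector_diff_chain_at) (auto intro!: derivative_eq_intros)
  then show ?thesis by (simp add: o_def)
qed

lemma U_in_domain:
  assumes "x \<in> D"
  shows "U t x \<in> D" "G (U t x) = U t (G x)"
proof -
  have "((\<lambda>s. U t (U s x)) has_vector_derivative U t (G x)) (at 0)"
    by (rule bounded_linear.has_vector_derivative[OF bounded_linear]) (use assms generator in blast)
  then have "((\<lambda>s. U s (U t x)) has_vector_derivative U t (G x)) (at 0)"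
    by (simp add: U_add[symmetric] add.commute)
  then show "U t x \<in> D" "G (U t x) = U t (G x)" using generator by auto
qed

lemma U_has_vector_derivative:
  "x \<in> D \<Longrightarrow> ((\<lambda>t. U t x) has_vector_derivative U t (G x)) (at t)"
  using has_vector_derivative_at_shift[of x "G x" t] generator[of x "G x"] by auto

lemma solution_unique:
  assumes uD: "\<And>t. u t \<in> D" and u: "\<And>t. (u has_vector_derivative G (u t)) (at t)"
  shows "u t = U t (u 0)"
proof -
  have "norm (u t - U t (u 0)) = norm (u 0 - U 0 (u 0))"
  proof (rule norm_constant_if_derivative_orthogonal)
    fix t
    show "((\<lambda>t. u t - U t (u 0)) has_vector_derivative G (u t) - U t (G (u 0))) (at t)"
      by (intro derivative_intros u U_has_vector_derivative uD)
    show "inner (G (u t) - U t (G (u 0))) (u t - U t (u 0)) = 0"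
      using skew[of "u t - U t (u 0)"] diff[OF uD U_in_domain(1)[OF uD], of t t 0]
      by (simp add: U_in_domain(2)[OF uD])
  qed
  then show ?thesis by simp
qed

lemma eq_if_eq_on_domain:
  fixes f g :: "'a \<Rightarrow> 'a"
  assumes "continuous_on UNIV f" "continuous_on UNIV g" "\<And>x. x \<in> D \<Longrightarrow> f x = g x"
  shows "f x = g x"
proof -
  have "closure D \<subseteq> {x. f x = g x}"
    by (rule closure_minimal) (use assms in \<open>auto intro: closed_Collect_eq\<close>)
  then show ?thesis using dense by auto
qed

lemma continuous_U: "continuous_on UNIV (U t)"
  by (intro linear_continuous_on bounded_linear)

text \<open>
  If \<open>C\<close> commutes with the generator then it maps solutions to solutions, and solutions are determined by their
  initial values. The main use is \<open>C x = i x\<close>, which makes a group of real linear maps complex linear.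
\<close>

lemma U_commute:
  assumes C: "bounded_linear C" and CD: "\<And>x. x \<in> D \<Longrightarrow> C x \<in> D \<and> G (C x) = C (G x)"
  shows "U t (C x) = C (U t x)"
proof -
  have cC: "continuous_on S C" for S by (intro linear_continuous_on C)
  show ?thesis
  proof (rule eq_if_eq_on_domain[where f = "\<lambda>x. U t (C x)" and g = "\<lambda>x. C (U t x)"])
    show "continuous_on UNIV (\<lambda>x. U t (C x))" "continuous_on UNIV (\<lambda>x. C (U t x))"
      by (rule continuous_on_compose2[OF continuous_U cC[of UNIV] subset_UNIV]
          continuous_on_compose2[OF cC[of UNIV] continuous_U subset_UNIV])+
    fix x assume x: "x \<in> D"
    have "C (U t x) = U t (C (U 0 x))"
    proof (rule solution_unique)
      fix t
      show "C (U t x) \<in> D" using CD U_in_domain x by auto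
      show "((\<lambda>t. C (U t x)) has_vector_derivative G (C (U t x))) (at t)"
        using bounded_linear.has_vector_derivative[OF C U_has_vector_derivative[OF x]] CD U_in_domain[OF x]
        by simp
    qed
    then show "U t (C x) = C (U t x)" by simp
  qed
qed

lemma generated_group_unique:
  assumes "generated_group D G V"
  shows "V t x = U t x"
proof -
  interpret V: generated_group D G V by fact
  show ?thesis
  proof (rule eq_if_eq_on_domain[OF V.continuous_U continuous_U])
    fix x assume x: "x \<in> D"
    have "V t x = U t (V 0 x)"
      by (rule solution_unique) (use V.U_in_domain[OF x] V.U_has_vector_derivative[OF x] in auto)
    then show "V t x = U t x" by simp
  qed
qed

end

context skew_adjoint
begin

abbreviation yosida_group where "yosida_group n \<equiv> op_exp (yosida n)"

lemma norm_yosida_group: "norm (yosida_group n t x) = norm x"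
  by (rule bounded_skew.norm_op_exp[OF bounded_skew_yosida])

lemma linear_yosida_group: "linear (yosida_group n t)"
  by (rule bounded_skew.linear_op_exp[OF bounded_skew_yosida])

text \<open>
  For vectors in the domain this is continuous dependence on the generator; all maps involved are isometric, so the
  estimate passes to the closure of the domain.
\<close>

lemma uniformly_Cauchy_yosida_group: "uniformly_Cauchy_on {-T..T} (\<lambda>n t. yosida_group n t x)"
  unfolding uniformly_Cauchy_on_def
proof (intro allI impI)
  fix e :: real assume e: "0 < e"
  obtain v where v: "v \<in> D" "dist v x < e / 3"
    using dense closure_approachable[of x D] e by (metis UNIV_I divide_pos_pos zero_less_numeral)
  \<comment> \<open>The summand one keeps \<open>K\<close> positive when \<open>T\<close> or \<open>v\<close> is zero.\<close>
  define K where "K = 4 * \<bar>T\<bar> * norm v + 1"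
  have K: "K > 0" by (simp add: K_def add_nonneg_pos)
  have "Cauchy (\<lambda>n. yosida n v)" using yosida_tendsto[OF v(1)] by (rule LIMSEQ_imp_Cauchy)
  then obtain M where M: "\<And>m n. m \<ge> M \<Longrightarrow> n \<ge> M \<Longrightarrow> norm (yosida m v - yosida n v) < (e / 3)\<^sup>2 / K"
    using CauchyD[of "\<lambda>n. yosida n v" "(e / 3)\<^sup>2 / K"] e K by auto
  have "dist (yosida_group m t x) (yosida_group n t x) < e" if t: "t \<in> {-T..T}" and mn: "m \<ge> M" "n \<ge> M" for t m n
  proof -
    have "(norm (yosida_group m t v - yosida_group n t v))\<^sup>2 \<le> 4 * \<bar>t\<bar> * norm v * norm (yosida m v - yosida n v)"
      by (intro op_exp_diff_bound bounded_skew_yosida yosida_commute)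
    also have "\<dots> \<le> K * norm (yosida m v - yosida n v)"
    proof (intro mult_right_mono norm_ge_zero)
      have "4 * \<bar>t\<bar> * norm v \<le> 4 * \<bar>T\<bar> * norm v" using t by (intro mult_right_mono) auto
      then show "4 * \<bar>t\<bar> * norm v \<le> K" by (simp add: K_def)
    qed
    also have "\<dots> < (e / 3)\<^sup>2" using M[OF mn] K by (simp add: field_simps)
    finally have 1: "norm (yosida_group m t v - yosida_group n t v) < e / 3" using e by (intro power2_less_imp_less[of _ "e / 3"]) auto
    have 2: "norm (yosida_group k t x - yosida_group k t v) < e / 3" for k
      using norm_yosida_group[of k t "x - v"] v(2) by (simp add: linear_diff[OF linear_yosida_group] dist_norm norm_minus_commute)
    have "norm (yosida_group m t x - yosida_group n t x) \<le> norm (yosida_group m t x - yosida_group m t v) + norm (yosida_group m t v - yosida_group n t v) + norm (yosida_group n t v - yosida_group n t x)"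
      using norm_triangle_ineq[of "yosida_group m t x - yosida_group m t v" "yosida_group m t v - yosida_group n t x"]
        norm_triangle_ineq[of "yosida_group m t v - yosida_group n t v" "yosida_group n t v - yosida_group n t x"] by simp
    then show ?thesis using 1 2[of m] 2[of n] by (simp add: dist_norm norm_minus_commute)
  qed
  then show "\<exists>M. \<forall>t\<in>{-T..T}. \<forall>m\<ge>M. \<forall>n\<ge>M. dist (yosida_group m t x) (yosida_group n t x) < e" by blast
qed

definition stone_group :: "real \<Rightarrow> 'a \<Rightarrow> 'a" where "stone_group t x = lim (\<lambda>n. yosida_group n t x)"

lemma yosida_group_uniform_limit: "uniform_limit {-T..T} (\<lambda>n t. yosida_group n t x) (\<lambda>t. stone_group t x) sequentially"
  using Cauchy_uniformly_convergent[OF uniformly_Cauchy_yosida_group]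
  unfolding uniformly_convergent_uniform_limit_iff stone_group_def .

lemma yosida_group_tendsto: "(\<lambda>n. yosida_group n t x) \<longlonglongrightarrow> stone_group t x"
  by (rule tendsto_uniform_limitI[OF yosida_group_uniform_limit[where T = "\<bar>t\<bar>"]]) auto

lemma norm_stone_group: "norm (stone_group t x) = norm x"
  using LIMSEQ_unique[OF tendsto_norm[OF yosida_group_tendsto[of t x]]] by (simp add: norm_yosida_group)

lemma linear_stone_group: "linear (stone_group t)"
proof
  fix x y :: 'a and c :: real
  show "stone_group t (x + y) = stone_group t x + stone_group t y"
    using LIMSEQ_unique[OF tendsto_add[OF yosida_group_tendsto yosida_group_tendsto], of t x t y "stone_group t (x + y)"]
      yosida_group_tendsto[of t "x + y"] by (simp add: linear_add[OF linear_yosida_group])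
  show "stone_group t (c *\<^sub>R x) = c *\<^sub>R stone_group t x"
    using LIMSEQ_unique[OF tendsto_scaleR[OF tendsto_const yosida_group_tendsto], of c t x "stone_group t (c *\<^sub>R x)"]
      yosida_group_tendsto[of t "c *\<^sub>R x"] by (simp add: linear_cmul[OF linear_yosida_group])
qed

lemma orthogonal_group_stone_group: "orthogonal_group stone_group"
proof (rule orthogonal_group.intro)
  fix s t :: real and x :: 'a
  show "linear (stone_group t)" by (rule linear_stone_group)
  show "norm (stone_group t x) = norm x" by (rule norm_stone_group)
  show "stone_group 0 x = x" using LIMSEQ_unique[OF yosida_group_tendsto[of 0 x]] by simp
  have "(\<lambda>n. yosida_group n s (yosida_group n t x - stone_group t x)) \<longlonglongrightarrow> 0"
  proof (rule tendsto_norm_zero_cancel)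
    show "(\<lambda>n. norm (yosida_group n s (yosida_group n t x - stone_group t x))) \<longlonglongrightarrow> 0"
      unfolding norm_yosida_group using yosida_group_tendsto[of t x] by (simp add: tendsto_norm_zero LIM_zero)
  qed
  from tendsto_add[OF this yosida_group_tendsto[of s "stone_group t x"]]
  have "(\<lambda>n. yosida_group n s (yosida_group n t x)) \<longlonglongrightarrow> stone_group s (stone_group t x)" by (simp add: linear_diff[OF linear_yosida_group])
  then have "(\<lambda>n. yosida_group n (s + t) x) \<longlonglongrightarrow> stone_group s (stone_group t x)"
    by (simp add: bounded_skew.op_exp_add[OF bounded_skew_yosida])
  from LIMSEQ_unique[OF yosida_group_tendsto this] show "stone_group (s + t) x = stone_group s (stone_group t x)" .
  have cont: "continuous_on {-T..T} (\<lambda>t. stone_group t x)" for T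
  proof (rule uniform_limit_theorem[OF _ yosida_group_uniform_limit])
    show "\<forall>\<^sub>F n in sequentially. continuous_on {-T..T} (\<lambda>t. yosida_group n t x)"
      by (rule always_eventually, rule allI,
        rule continuous_on_vector_derivative[OF has_vector_derivative_at_within[OF
          op_exp_has_vector_derivative[OF bounded_skew.bounded_linear[OF bounded_skew_yosida]]]])
  qed simp
  show "continuous_on UNIV (\<lambda>t. stone_group t x)"
  proof (rule continuous_at_imp_continuous_on, intro ballI)
    fix t :: real
    have "continuous_on {- (\<bar>t\<bar> + 1)<..<\<bar>t\<bar> + 1} (\<lambda>t. stone_group t x)"
      by (rule continuous_on_subset[OF cont[of "\<bar>t\<bar> + 1"]]) auto
    moreover have "t \<in> {- (\<bar>t\<bar> + 1)<..<\<bar>t\<bar> + 1}" unfolding greaterThanLessThan_iff by linarith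
    ultimately show "isCont (\<lambda>t. stone_group t x) t" by (simp add: continuous_on_eq_continuous_at)
  qed
qed

text \<open>
  The derivatives of the approximating orbits are \<open>yosida_group n t (yosida n x)\<close> and converge to
  \<open>stone_group t (G x)\<close> uniformly for bounded \<open>t\<close>, so the limit may be differentiated.
\<close>

lemma stone_group_has_vector_derivative_0:
  assumes x: "x \<in> D"
  shows "((\<lambda>t. stone_group t x) has_vector_derivative G x) (at 0)"
proof -
  note bl = bounded_skew.bounded_linear[OF bounded_skew_yosida]
  have "\<exists>g. \<forall>t\<in>{-1..1}. (\<lambda>n. yosida_group n t x) \<longlonglongrightarrow> g t \<and> (g has_derivative (\<lambda>h. h *\<^sub>R stone_group t (G x))) (at t within {-1..1})"
  proof (rule has_derivative_sequence[where f' = "\<lambda>n t (h::real). h *\<^sub>R yosida_group n t (yosida n x)"])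
    fix n and t :: real
    have "((\<lambda>t. yosida_group n t x) has_vector_derivative yosida_group n t (yosida n x)) (at t)"
      using op_exp_has_vector_derivative[OF bl, of n x t] by (simp add: op_exp_commute[OF bl bl])
    then show "((\<lambda>t. yosida_group n t x) has_derivative (\<lambda>h. h *\<^sub>R yosida_group n t (yosida n x))) (at t within {-1..1})"
      unfolding has_vector_derivative_def by (rule has_derivative_at_withinI)
  next
    fix e :: real assume e: "0 < e"
    have "\<forall>\<^sub>F n in sequentially. dist (yosida n x) (G x) < e / 2"
      using tendstoD[OF yosida_tendsto[OF x], of "e / 2"] e by simp
    moreover have "\<forall>\<^sub>F n in sequentially. \<forall>t\<in>{-1..1}. dist (yosida_group n t (G x)) (stone_group t (G x)) < e / 2"
      by (rule uniform_limitD[OF yosida_group_uniform_limit]) (use e in simp)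
    ultimately show "\<forall>\<^sub>F n in sequentially. \<forall>t\<in>{-1..1}. \<forall>h. norm (h *\<^sub>R yosida_group n t (yosida n x) - h *\<^sub>R stone_group t (G x)) \<le> e * norm h"
    proof (rule eventually_elim2, intro ballI allI)
      fix n and t h :: real
      assume 1: "dist (yosida n x) (G x) < e / 2" and 2: "\<forall>t\<in>{-1..1}. dist (yosida_group n t (G x)) (stone_group t (G x)) < e / 2"
        and t: "t \<in> {-1..1}"
      have "norm (yosida_group n t (yosida n x) - yosida_group n t (G x)) < e / 2"
        using 1 norm_yosida_group[of n t "yosida n x - G x"] by (simp add: linear_diff[OF linear_yosida_group] dist_norm)
      with 2[rule_format, OF t] have "norm (yosida_group n t (yosida n x) - stone_group t (G x)) < e"
        using dist_triangle_lt[of "yosida_group n t (yosida n x)" "yosida_group n t (G x)" "stone_group t (G x)" e]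
        by (simp add: dist_norm norm_minus_commute)
      then have "\<bar>h\<bar> * norm (yosida_group n t (yosida n x) - stone_group t (G x)) \<le> \<bar>h\<bar> * e" by (intro mult_left_mono) auto
      then show "norm (h *\<^sub>R yosida_group n t (yosida n x) - h *\<^sub>R stone_group t (G x)) \<le> e * norm h"
        by (simp add: scaleR_diff_right[symmetric] mult.commute del: scaleR_diff_right)
    qed
  next
    show "(\<lambda>n. yosida_group n 0 x) \<longlonglongrightarrow> x" by simp
  qed auto
  then obtain g where g: "\<forall>t\<in>{-1..1}. (\<lambda>n. yosida_group n t x) \<longlonglongrightarrow> g t \<and> (g has_derivative (\<lambda>h. h *\<^sub>R stone_group t (G x))) (at t within {-1..1})"
    by blast
  have eq: "g t = stone_group t x" if t: "t \<in> {-1<..<1}" for t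
  proof -
    have "(\<lambda>n. yosida_group n t x) \<longlonglongrightarrow> g t" using bspec[OF g, of t] t by simp
    from LIMSEQ_unique[OF this yosida_group_tendsto] show ?thesis .
  qed
  have "at 0 within {-1..1::real} = at 0" by (rule at_within_interior) simp
  with g have "(g has_vector_derivative stone_group 0 (G x)) (at 0)"
    unfolding has_vector_derivative_def by (metis atLeastAtMost_iff neg_le_0_iff_le zero_le_one)
  then have "((\<lambda>t. stone_group t x) has_vector_derivative stone_group 0 (G x)) (at 0)"
    by (rule has_vector_derivative_transform_within_open[where S = "{-1<..<1}"]) (use eq in auto)
  then show ?thesis by (simp add: orthogonal_group.U_0[OF orthogonal_group_stone_group])
qed

text \<open>
  The generator is not larger than \<open>G\<close>: if the orbit of \<open>x\<close> has derivative \<open>z\<close> at zero, then differentiating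
  \<open>\<langle>stone_group t u, x\<rangle> = \<langle>u, stone_group (- t) x\<rangle>\<close> for \<open>u\<close> in the domain of \<open>G\<close> shows that
  \<open>(x, z)\<close> lies in the graph of minus the adjoint of \<open>G\<close>, hence in the graph of \<open>G\<close>.
\<close>

lemma generated_group_stone_group: "generated_group D G stone_group"
proof -
  interpret lim: orthogonal_group stone_group by (rule orthogonal_group_stone_group)
  have gen: "x \<in> D \<and> z = G x" if z: "((\<lambda>t. stone_group t x) has_vector_derivative z) (at 0)" for x z
  proof -
    have "inner (G u) x = - inner u z" if u: "u \<in> D" for u
    proof -
      have 1: "((\<lambda>t. inner (stone_group t u) x) has_vector_derivative inner (G u) x) (at 0)"
        by (rule bounded_linear.has_vector_derivative[OF bounded_linear_inner_left stone_group_has_vector_derivative_0[OF u]])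
      have "((\<lambda>t::real. - t) has_vector_derivative - 1) (at 0)"
        by (rule has_vector_derivative_minus[OF has_vector_derivative_id])
      then have "((\<lambda>t. stone_group (- t) x) has_vector_derivative - z) (at 0)"
        using vector_diff_chain_at[of "\<lambda>t. - t" "-1" 0 "\<lambda>t. stone_group t x" z] z by (simp add: o_def)
      then have "((\<lambda>t. inner u (stone_group (- t) x)) has_vector_derivative inner u (- z)) (at 0)"
        by (rule bounded_linear.has_vector_derivative[OF bounded_linear_inner_right])
      then have "((\<lambda>t. inner (stone_group t u) x) has_vector_derivative inner u (- z)) (at 0)"
        by (simp only: lim.inner_adjoint)
      from vector_derivative_unique_at[OF 1 this] show ?thesis by simp
    qed
    then show ?thesis using graph[of x z] by blast
  qed
  show ?thesis
    by unfold_locales (use gen stone_group_has_vector_derivative_0 in blast)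
qed

end

section \<open>Range and null space of the generator\<close>

context generated_group
begin

text \<open>
  The component of \<open>y\<close> orthogonal to the range lies in the null space, because \<open>G\<close> is minus its own adjoint;
  so it is orthogonal to \<open>y\<close> and therefore zero.
\<close>

lemma closure_range_if_orthogonal_null_space:
  assumes y: "\<And>v. v \<in> D \<Longrightarrow> G v = 0 \<Longrightarrow> inner y v = 0"
  shows "y \<in> closure (G ` D)"
proof -
  have sub: "subspace (G ` D)"
  proof (rule subspaceI)
    show "0 \<in> G ` D" using scale[of 0 0] subspace_0[OF subspace_domain] by (intro image_eqI[of _ _ 0]) auto
    show "u + v \<in> G ` D" if "u \<in> G ` D" "v \<in> G ` D" for u v
      using that add by (metis (no_types, lifting) image_iff)
    show "c *\<^sub>R u \<in> G ` D" if "u \<in> G ` D" for c u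
      using that scale by (metis (no_types, lifting) image_iff)
  qed
  obtain p where p: "p \<in> closure (G ` D)" and orth: "\<And>s. s \<in> closure (G ` D) \<Longrightarrow> inner (y - p) s = 0"
    using closed_subspace_projection[of "closure (G ` D)" y] sub by (auto intro: subspace_closure)
  have "inner (G u) (y - p) = - inner u 0" if "u \<in> D" for u
  proof -
    have "G u \<in> closure (G ` D)" using that by (intro subsetD[OF closure_subset] imageI)
    from orth[OF this] show ?thesis by (simp add: inner_commute)
  qed
  then have "y - p \<in> D" "G (y - p) = 0" using graph[of "y - p" 0] by auto
  then have "inner y (y - p) = 0" using y by blast
  moreover have "inner p (y - p) = 0" using orth[OF p] by (simp add: inner_commute)
  ultimately have "inner (y - p) (y - p) = 0" by (simp add: inner_diff_left)
  then show ?thesis using p by simp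
qed

lemma has_vector_derivative_U_reversed:
  assumes "x \<in> D"
  shows "((\<lambda>s. U (t - s) x) has_vector_derivative - U (t - s) (G x)) (at s within S)"
proof -
  have "((\<lambda>s. t - s) has_vector_derivative 0 - 1) (at s)"
    by (intro derivative_intros)
  from vector_diff_chain_at[OF this U_has_vector_derivative[OF assms]]
  show ?thesis by (simp add: o_def has_vector_derivative_at_within)
qed

end

section \<open>Averages along the group with a vanishing damping\<close>

lemma continuous_scale_integrable:
  assumes f: "continuous_on {s..t} f" and g: "(g :: real \<Rightarrow> real) integrable_on {s..t}" and nonneg: "\<And>r. 0 \<le> g r"
  shows "(\<lambda>r. f r * g r) integrable_on {s..t}"
proof -
  have "(\<lambda>r. f r * g r) absolutely_integrable_on {s..t}"
  proof (rule absolutely_integrable_bounded_measurable_product_real)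
    show "f \<in> borel_measurable (lebesgue_on {s..t})"
      by (rule continuous_imp_measurable_on_sets_lebesgue[OF f]) auto
    show "bounded (f ` {s..t})"
      by (intro compact_imp_bounded compact_continuous_image f) auto
    show "g absolutely_integrable_on {s..t}"
      using g by (simp add: nonnegative_absolutely_integrable_1 nonneg)
  qed auto
  then show ?thesis by (rule set_lebesgue_integral_eq_integral)
qed

locale damping =
  fixes a a' :: "real \<Rightarrow> real"
  assumes pos: "t \<ge> 0 \<Longrightarrow> a t > 0"
    and cont: "continuous_on {0..} a"
    and deriv: "t \<ge> 0 \<Longrightarrow> (a has_real_derivative a' t) (at t within {0..})"
    and lim: "(a \<longlongrightarrow> 0) at_top"
    and abs_integrable: "(\<lambda>t. a' t + (a t)\<^sup>2) absolutely_integrable_on {0<..}"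
    and divergent: "filterlim (\<lambda>t. integral {0..t} a) at_top at_top"
begin

text \<open>
  In terms of this primitive of \<open>a\<close> the damping factor from time \<open>s\<close> to time \<open>t\<close> is
  \<open>exp (total_damping s - total_damping t)\<close>, an expression that is easily differentiated in \<open>s\<close>.
\<close>

definition total_damping :: "real \<Rightarrow> real" where "total_damping t = integral {0..t} a"

lemma a_integrable: "0 \<le> s \<Longrightarrow> a integrable_on {s..t}"
  by (intro integrable_continuous_real continuous_on_subset[OF cont]) auto

lemma total_damping_0 [simp]: "total_damping 0 = 0" by (simp add: total_damping_def)

lemma integral_eq_total_damping_diff: "0 \<le> s \<Longrightarrow> s \<le> t \<Longrightarrow> integral {s..t} a = total_damping t - total_damping s"
  using Henstock_Kurzweil_Integration.integral_combine[of 0 s t a] a_integrable[of 0 t] by (simp add: total_damping_def)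

lemma total_damping_mono: "0 \<le> s \<Longrightarrow> s \<le> t \<Longrightarrow> total_damping s \<le> total_damping t"
  using integral_eq_total_damping_diff[of s t] integral_nonneg[OF a_integrable[of s t]] pos by (simp add: less_imp_le)

lemma total_damping_deriv:
  assumes "0 \<le> s" "s \<le> t"
  shows "(total_damping has_real_derivative a s) (at s within {0..t})"
  unfolding total_damping_def
  by (rule integral_has_real_derivative) (use assms in \<open>auto intro: continuous_on_subset[OF cont]\<close>)

lemma total_damping_continuous: "continuous_on {0..t} total_damping"
  by (rule DERIV_continuous_on[of _ total_damping a]) (use total_damping_deriv in auto)

lemma decay_tendsto_0: "((\<lambda>t. exp (c - total_damping t)) \<longlongrightarrow> 0) at_top"
proof -
  have "filterlim (\<lambda>t. - total_damping t) at_bot at_top"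
    using divergent by (simp add: filterlim_uminus_at_top total_damping_def)
  then have "filterlim (\<lambda>t. c + (- total_damping t)) at_bot at_top"
    by (simp only: filterlim_tendsto_add_at_bot_iff[OF tendsto_const])
  then show ?thesis using filterlim_compose[OF exp_at_bot] by fastforce
qed

text \<open>
  The derivative of \<open>a s exp (total_damping s)\<close> is \<open>(a' s + (a s)\<^sup>2) exp (total_damping s)\<close>; the defect measures
  how far this weight is from being constant.
\<close>

definition defect :: "real \<Rightarrow> real" where "defect t = \<bar>a' t + (a t)\<^sup>2\<bar>"

lemma defect_nonneg: "0 \<le> defect t" by (simp add: defect_def)

lemma defect_integrable_on_half_line: "defect integrable_on {0..}"
proof -
  have "defect integrable_on {0<..}"
    using abs_integrable unfolding absolutely_integrable_on_def defect_def[abs_def] by simp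
  moreover have "{0..} = insert 0 {0::real<..}" by auto
  ultimately show ?thesis by (simp add: integrable_on_insert_iff)
qed

lemma defect_integrable: "0 \<le> s \<Longrightarrow> defect integrable_on {s..t}"
  using defect_integrable_on_half_line by (rule integrable_on_subinterval) auto

abbreviation weight :: "real \<Rightarrow> real \<Rightarrow> real" where "weight t s \<equiv> exp (total_damping s - total_damping t)"

lemma weight_continuous: "0 \<le> s \<Longrightarrow> continuous_on {s..t} (weight t)"
  by (intro continuous_intros continuous_on_subset[OF total_damping_continuous[of t]]) auto

lemma weight_le_1: "0 \<le> s \<Longrightarrow> s \<le> t \<Longrightarrow> weight t s \<le> 1"
  using total_damping_mono by simp

lemma weight_defect_integrable: "0 \<le> s \<Longrightarrow> (\<lambda>r. weight t r * defect r) integrable_on {s..t}"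
  by (intro continuous_scale_integrable weight_continuous defect_integrable defect_nonneg)

lemma defect_tail:
  assumes "e > 0"
  obtains T where "0 \<le> T" "\<And>t. T \<le> t \<Longrightarrow> integral {T..t} defect < e"
proof -
  define A where "A = (\<lambda>t. integral {0..t} defect) ` {0..}"
  have bdd: "bdd_above A"
  proof (rule bdd_aboveI)
    fix r assume "r \<in> A"
    then obtain t where t: "0 \<le> t" "r = integral {0..t} defect" by (auto simp: A_def)
    have "integral {0..t} defect \<le> integral {0..} defect"
      by (rule integral_subset_le) (simp_all add: defect_integrable defect_integrable_on_half_line defect_nonneg)
    then show "r \<le> integral {0..} defect" using t by simp
  qed
  have "Sup A - e < Sup A" using assms by simp
  then obtain r where r: "r \<in> A" "Sup A - e < r"
    by (rule less_cSupE) (auto simp: A_def)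
  then obtain T where T: "0 \<le> T" "r = integral {0..T} defect" by (auto simp: A_def)
  show ?thesis
  proof (rule that[OF T(1)])
    fix t assume t: "T \<le> t"
    have "integral {0..t} defect \<le> Sup A" by (rule cSup_upper[OF _ bdd]) (use t T in \<open>auto simp: A_def\<close>)
    moreover have "integral {0..T} defect + integral {T..t} defect = integral {0..t} defect"
      by (rule Henstock_Kurzweil_Integration.integral_combine[OF T(1) t]) (simp add: defect_integrable)
    ultimately show "integral {T..t} defect < e" using r T by simp
  qed
qed

text \<open>
  Split at a time \<open>T\<close> after which the defect has small integral. After \<open>T\<close> the weight is at most one; before
  \<open>T\<close> it is at most the weight at \<open>T\<close>, which tends to zero.
\<close>

lemma weight_defect_tendsto_0: "((\<lambda>t. integral {0..t} (\<lambda>s. weight t s * defect s)) \<longlongrightarrow> 0) at_top"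
proof (rule tendstoI)
  fix e :: real assume e: "0 < e"
  obtain T where T: "0 \<le> T" "\<And>t. T \<le> t \<Longrightarrow> integral {T..t} defect < e / 2"
    using defect_tail[of "e / 2"] e by auto
  have "((\<lambda>t. weight t T * integral {0..T} defect) \<longlongrightarrow> 0 * integral {0..T} defect) at_top"
    by (intro tendsto_intros decay_tendsto_0)
  then have "\<forall>\<^sub>F t in at_top. weight t T * integral {0..T} defect < e / 2"
    by (rule order_tendstoD) (use e in auto)
  then show "\<forall>\<^sub>F t in at_top. dist (integral {0..t} (\<lambda>s. weight t s * defect s)) 0 < e"
    using eventually_ge_at_top[of T]
  proof eventually_elim
    case (elim t)
    have int: "(\<lambda>s. weight t s * defect s) integrable_on {0..t}" by (rule weight_defect_integrable) simp
    have "integral {0..T} (\<lambda>s. weight t s * defect s) \<le> integral {0..T} (\<lambda>s. weight t T * defect s)"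
    proof (rule integral_le)
      show "(\<lambda>s. weight t s * defect s) integrable_on {0..T}"
        by (rule integrable_on_subinterval[OF int]) (use elim in auto)
      show "(\<lambda>s. weight t T * defect s) integrable_on {0..T}"
        using defect_integrable[of 0 T] by (rule integrable_on_mult_right) simp
    qed (use total_damping_mono defect_nonneg in \<open>auto intro!: mult_right_mono\<close>)
    also have "\<dots> = weight t T * integral {0..T} defect" by (rule integral_mult_right)
    also have "\<dots> < e / 2" by (rule elim)
    finally have 1: "integral {0..T} (\<lambda>s. weight t s * defect s) < e / 2" .
    have "integral {T..t} (\<lambda>s. weight t s * defect s) \<le> integral {T..t} defect"
      by (rule integral_le)
        (use weight_defect_integrable defect_integrable T(1) weight_le_1 defect_nonneg in \<open>auto intro!: mult_left_le_one_le\<close>)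
    also have "\<dots> < e / 2" using T elim by simp
    finally have 2: "integral {T..t} (\<lambda>s. weight t s * defect s) < e / 2" .
    have "integral {0..T} (\<lambda>s. weight t s * defect s) + integral {T..t} (\<lambda>s. weight t s * defect s) = integral {0..t} (\<lambda>s. weight t s * defect s)"
      by (rule Henstock_Kurzweil_Integration.integral_combine[OF T(1) elim(2) int])
    moreover have "0 \<le> integral {0..t} (\<lambda>s. weight t s * defect s)"
      by (rule integral_nonneg[OF int]) (simp add: defect_nonneg)
    ultimately show ?case using 1 2 by (simp add: dist_real_def)
  qed
qed

end

locale damped_group = generated_group D G U + damping a a'
  for D :: "'a::{real_inner,banach} set" and G U and a a' :: "real \<Rightarrow> real"
begin

lemma U_reversed_continuous: "continuous_on S (\<lambda>s. U (t - s) x)"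
  by (rule continuous_on_compose2[OF continuous]) (auto intro: continuous_intros)

lemma weighted_integrable:
  "continuous_on {0..t} c \<Longrightarrow> (\<lambda>s. (c s * weight t s) *\<^sub>R U (t - s) x) integrable_on {0..t}"
  by (intro integrable_continuous_real continuous_intros weight_continuous U_reversed_continuous) auto

lemma weight_integrable: "(\<lambda>s. weight t s *\<^sub>R U (t - s) x) integrable_on {0..t}"
  using weighted_integrable[of t "\<lambda>_. 1" x] by simp

lemma a_continuous: "continuous_on {0..t} a"
  by (rule continuous_on_subset[OF cont]) auto

lemma weight_has_derivative:
  "0 \<le> s \<Longrightarrow> s \<le> t \<Longrightarrow> (weight t has_real_derivative weight t s * a s) (at s within {0..t})"
  by (auto intro!: derivative_eq_intros total_damping_deriv)

lemma norm_weight_integral_le: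
  assumes "0 \<le> t"
  shows "norm (integral {0..t} (\<lambda>s. weight t s *\<^sub>R U (t - s) x)) \<le> t * norm x"
proof -
  have "norm (integral {0..t} (\<lambda>s. weight t s *\<^sub>R U (t - s) x)) \<le> integral {0..t} (\<lambda>_. norm x)"
    by (rule integral_norm_bound_integral[OF weight_integrable])
      (use weight_le_1 in \<open>auto intro!: mult_left_le_one_le\<close>)
  then show ?thesis using assms by simp
qed

text \<open>
  The fundamental theorem of calculus for \<open>s \<mapsto> weight t s U (t - s) x\<close>, where
  \<open>U (t - s) (G x)\<close> is minus the derivative of \<open>U (t - s) x\<close> in \<open>s\<close>.
\<close>

lemma integral_by_parts:
  assumes x: "x \<in> D" and t: "0 \<le> t"
  shows "integral {0..t} (\<lambda>s. weight t s *\<^sub>R U (t - s) (G x)) =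
    integral {0..t} (\<lambda>s. (a s * weight t s) *\<^sub>R U (t - s) x) + exp (- total_damping t) *\<^sub>R U t x - x"
proof -
  let ?f = "\<lambda>s. weight t s *\<^sub>R U (t - s) x"
  have "((\<lambda>s. weight t s *\<^sub>R - U (t - s) (G x) + (weight t s * a s) *\<^sub>R U (t - s) x) has_integral ?f t - ?f 0) {0..t}"
  proof (rule fundamental_theorem_of_calculus[OF t])
    fix s assume "s \<in> {0..t}"
    then show "(?f has_vector_derivative weight t s *\<^sub>R - U (t - s) (G x) + (weight t s * a s) *\<^sub>R U (t - s) x) (at s within {0..t})"
      by (intro has_vector_derivative_scaleR weight_has_derivative has_vector_derivative_U_reversed x) auto
  qed
  then have "integral {0..t} (\<lambda>s. (a s * weight t s) *\<^sub>R U (t - s) x - weight t s *\<^sub>R U (t - s) (G x)) = x - exp (- total_damping t) *\<^sub>R U t x"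
    by (simp add: integral_unique mult.commute)
  then show ?thesis
    using integral_diff[OF weighted_integrable[OF a_continuous] weight_integrable, of t x "G x"] by (simp add: algebra_simps)
qed

lemma a_weight_integral: 
  assumes t: "0 \<le> t"
  shows "((\<lambda>s. a s * weight t s) has_integral 1 - exp (- total_damping t)) {0..t}"
proof -
  have "((\<lambda>s. weight t s * a s) has_integral weight t t - weight t 0) {0..t}"
    by (rule fundamental_theorem_of_calculus[OF t])
      (use weight_has_derivative in \<open>auto simp: has_real_derivative_iff_has_vector_derivative\<close>)
  then show ?thesis by (simp add: mult.commute)
qed

text \<open>
  The averages are contractions: \<open>a s weight t s\<close> is the derivative of \<open>weight t s\<close> in \<open>s\<close>, so its integral is the
  increase of the weight, which is at most one.
\<close>

lemma norm_average_le:
  assumes t: "0 \<le> t"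
  shows "norm (integral {0..t} (\<lambda>s. (a s * weight t s) *\<^sub>R U (t - s) x)) \<le> norm x"
proof -
  have "norm (integral {0..t} (\<lambda>s. (a s * weight t s) *\<^sub>R U (t - s) x)) \<le> integral {0..t} (\<lambda>s. a s * weight t s * norm x)"
  proof (rule integral_norm_bound_integral[OF weighted_integrable[OF a_continuous]])
    show "(\<lambda>s. a s * weight t s * norm x) integrable_on {0..t}"
      by (rule integrable_on_mult_left[OF has_integral_integrable[OF a_weight_integral[OF t]]])
  qed (simp add: abs_mult less_imp_le[OF pos])
  also have "\<dots> = (1 - exp (- total_damping t)) * norm x"
    using integral_unique[OF has_integral_mult_left[OF a_weight_integral[OF t]]] .
  also have "\<dots> \<le> norm x" by (rule mult_left_le_one_le) (use total_damping_mono[of 0 t] t in auto)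
  finally show ?thesis .
qed

text \<open>
  A second integration by parts. As \<open>a'\<close> need not be continuous, integrability of the term that contains it
  is read off from the fundamental theorem by subtracting the continuous term.
\<close>

lemma norm_average_range_le:
  assumes x: "x \<in> D" and t: "0 \<le> t"
  shows "norm (integral {0..t} (\<lambda>s. (a s * weight t s) *\<^sub>R U (t - s) (G x)))
    \<le> (a t + a 0 * exp (- total_damping t) + integral {0..t} (\<lambda>s. weight t s * defect s)) * norm x"
proof -
  let ?f = "\<lambda>s. (a s * weight t s) *\<^sub>R U (t - s) x"
  let ?r = "\<lambda>s. (weight t s * (a' s + (a s)\<^sup>2)) *\<^sub>R U (t - s) x"
  have "((\<lambda>s. (a s * weight t s) *\<^sub>R - U (t - s) (G x) + (a s * (weight t s * a s) + a' s * weight t s) *\<^sub>R U (t - s) x) has_integral ?f t - ?f 0) {0..t}"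
  proof (rule fundamental_theorem_of_calculus[OF t])
    fix s assume s: "s \<in> {0..t}"
    have "(a has_real_derivative a' s) (at s within {0..t})"
      by (rule DERIV_subset[OF deriv]) (use s in auto)
    then show "(?f has_vector_derivative (a s * weight t s) *\<^sub>R - U (t - s) (G x) + (a s * (weight t s * a s) + a' s * weight t s) *\<^sub>R U (t - s) x) (at s within {0..t})"
      using s by (intro has_vector_derivative_scaleR DERIV_mult' weight_has_derivative has_vector_derivative_U_reversed x) auto
  qed
  then have 1: "((\<lambda>s. (a s * weight t s) *\<^sub>R - U (t - s) (G x) + ?r s) has_integral ?f t - ?f 0) {0..t}"
    by (simp add: algebra_simps power2_eq_square)
  have 2: "((\<lambda>s. (a s * weight t s) *\<^sub>R U (t - s) (G x)) has_integral
      integral {0..t} (\<lambda>s. (a s * weight t s) *\<^sub>R U (t - s) (G x))) {0..t}"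
    by (intro integrable_integral weighted_integrable a_continuous)
  have r: "(?r has_integral (?f t - ?f 0) + integral {0..t} (\<lambda>s. (a s * weight t s) *\<^sub>R U (t - s) (G x))) {0..t}"
    using has_integral_add[OF 1 2] by simp
  have "norm (integral {0..t} ?r) \<le> integral {0..t} (\<lambda>s. weight t s * defect s * norm x)"
  proof (rule integral_norm_bound_integral[OF has_integral_integrable[OF r]])
    show "(\<lambda>s. weight t s * defect s * norm x) integrable_on {0..t}"
      by (rule integrable_on_mult_left) (simp add: weight_defect_integrable)
  qed (simp add: abs_mult defect_def)
  also have "\<dots> = integral {0..t} (\<lambda>s. weight t s * defect s) * norm x" by (rule integral_mult_left)
  finally have 3: "norm (integral {0..t} ?r) \<le> integral {0..t} (\<lambda>s. weight t s * defect s) * norm x" .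
  have "integral {0..t} (\<lambda>s. (a s * weight t s) *\<^sub>R U (t - s) (G x)) = integral {0..t} ?r - ?f t + ?f 0"
    using integral_unique[OF r] by simp
  then have "norm (integral {0..t} (\<lambda>s. (a s * weight t s) *\<^sub>R U (t - s) (G x)))
      \<le> norm (integral {0..t} ?r) + norm (?f t) + norm (?f 0)"
    using norm_triangle_ineq[of "integral {0..t} ?r - ?f t" "?f 0"] norm_triangle_ineq4[of "integral {0..t} ?r" "?f t"] by simp
  moreover have "norm (?f t) = a t * norm x" using less_imp_le[OF pos[OF t]] by simp
  moreover have "norm (?f 0) = a 0 * exp (- total_damping t) * norm x" using less_imp_le[OF pos[of 0]] by (simp add: abs_mult)
  ultimately show ?thesis using 3 unfolding distrib_right by linarith
qed

lemma average_tendsto_0: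
  assumes y: "y \<in> closure (G ` D)"
  shows "((\<lambda>t. integral {0..t} (\<lambda>s. (a s * weight t s) *\<^sub>R U (t - s) y)) \<longlongrightarrow> 0) at_top"
proof (rule tendstoI)
  fix e :: real assume e: "0 < e"
  obtain x where x: "x \<in> D" "dist (G x) y < e / 2"
    using y closure_approachable[of y "G ` D"] e by (metis half_gt_zero imageE)
  have "((\<lambda>t. (a t + a 0 * exp (- total_damping t) + integral {0..t} (\<lambda>s. weight t s * defect s)) * norm x) \<longlongrightarrow> (0 + a 0 * 0 + 0) * norm x) at_top"
    using decay_tendsto_0[of 0] by (intro tendsto_intros lim weight_defect_tendsto_0) simp
  then have "\<forall>\<^sub>F t in at_top. (a t + a 0 * exp (- total_damping t) + integral {0..t} (\<lambda>s. weight t s * defect s)) * norm x < e / 2"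
    by (rule order_tendstoD) (use e in auto)
  then show "\<forall>\<^sub>F t in at_top. dist (integral {0..t} (\<lambda>s. (a s * weight t s) *\<^sub>R U (t - s) y)) 0 < e"
    using eventually_ge_at_top[of 0]
  proof eventually_elim
    case (elim t)
    let ?M = "\<lambda>x. integral {0..t} (\<lambda>s. (a s * weight t s) *\<^sub>R U (t - s) x)"
    have "?M y = ?M (G x) + ?M (y - G x)"
      unfolding linear_diff[OF linear] scaleR_diff_right
      by (subst integral_diff) (auto intro!: weighted_integrable a_continuous)
    then have "norm (?M y) \<le> norm (?M (G x)) + norm (?M (y - G x))" by (simp only: norm_triangle_ineq)
    moreover have "norm (?M (G x)) < e / 2" using norm_average_range_le[OF x(1) elim(2)] elim(1) by simp
    moreover have "norm (?M (y - G x)) < e / 2"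
      using norm_average_le[OF elim(2), of "y - G x"] x(2) by (simp add: dist_norm norm_minus_commute)
    ultimately show ?case by (simp add: dist_norm)
  qed
qed

lemma regularized_solution_tendsto:
  assumes "y \<in> D" and y: "\<And>v. v \<in> D \<Longrightarrow> G v = 0 \<Longrightarrow> inner y v = 0"
  shows "((\<lambda>t. integral {0..t} (\<lambda>s. weight t s *\<^sub>R U (t - s) (G y))) \<longlongrightarrow> - y) at_top"
proof -
  have 1: "((\<lambda>t. exp (- total_damping t) *\<^sub>R U t y) \<longlongrightarrow> 0) at_top"
    using tendsto_mult_left_zero[OF decay_tendsto_0[of 0], of "norm y"]
    by (intro tendsto_norm_zero_cancel[of "\<lambda>t. exp (- total_damping t) *\<^sub>R U t y"]) simp
  have "((\<lambda>t. integral {0..t} (\<lambda>s. (a s * weight t s) *\<^sub>R U (t - s) y) + exp (- total_damping t) *\<^sub>R U t y - y) \<longlongrightarrow> 0 + 0 - y) at_top"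
    by (intro tendsto_intros average_tendsto_0 1 closure_range_if_orthogonal_null_space y)
  then have "((\<lambda>t. integral {0..t} (\<lambda>s. (a s * weight t s) *\<^sub>R U (t - s) y) + exp (- total_damping t) *\<^sub>R U t y - y) \<longlongrightarrow> - y) at_top"
    by simp
  then show ?thesis
  proof (rule Lim_transform_eventually)
    show "\<forall>\<^sub>F t in at_top. integral {0..t} (\<lambda>s. (a s * weight t s) *\<^sub>R U (t - s) y) + exp (- total_damping t) *\<^sub>R U t y - y
        = integral {0..t} (\<lambda>s. weight t s *\<^sub>R U (t - s) (G y))"
      using eventually_ge_at_top[of 0] by (rule eventually_mono) (simp only: integral_by_parts[OF assms(1)])
  qed
qed

end

section \<open>Selfadjoint operators in complex Hilbert spaces\<close>

lemma scaleC_0_right [simp]: "c *\<^sub>C (0::'a::complex_hilbert_space) = 0"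
  using scaleC_add_right[of c "0::'a" 0] by simp

lemma scaleC_minus_right: "c *\<^sub>C (- x :: 'a::complex_hilbert_space) = - (c *\<^sub>C x)"
  using scaleC_add_right[of c x "- x"] by (simp add: add_eq_0_iff2)

lemma scaleC_diff_right: "c *\<^sub>C (x - y :: 'a::complex_hilbert_space) = c *\<^sub>C x - c *\<^sub>C y"
  using scaleC_add_right[of c x "- y"] by (simp add: scaleC_minus_right)

lemma scaleC_scaleR_commute: "c *\<^sub>C (r *\<^sub>R x) = r *\<^sub>R (c *\<^sub>C (x :: 'a::complex_hilbert_space))"
  by (simp add: scaleR_scaleC scaleC_scaleC mult.commute)

lemma scaleC_uminus_left: "(- c) *\<^sub>C x = - (c *\<^sub>C (x :: 'a::complex_hilbert_space))"
proof -
  have "(- c) *\<^sub>C x = complex_of_real (- 1) *\<^sub>C c *\<^sub>C x" by (simp add: scaleC_scaleC)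
  then show ?thesis by (simp only: scaleR_scaleC[symmetric]) simp
qed

lemma scaleC_eq_Re_Im: "c *\<^sub>C x = Re c *\<^sub>R x + Im c *\<^sub>R (\<i> *\<^sub>C (x :: 'a::complex_hilbert_space))"
proof -
  have "c *\<^sub>C x = (complex_of_real (Re c) + complex_of_real (Im c) * \<i>) *\<^sub>C x"
    using complex_eq[of c] by (simp add: mult.commute)
  then show ?thesis by (simp add: scaleC_add_left scaleR_scaleC scaleC_scaleC)
qed

lemma scaleC_i_i: "\<i> *\<^sub>C (\<i> *\<^sub>C x) = - (x :: 'a::complex_hilbert_space)"
  using scaleC_eq_Re_Im[of "- 1" x] by (simp add: scaleC_scaleC)

lemma cinner_scaleC_right: "cinner x (c *\<^sub>C y) = cnj c * cinner x (y :: 'a::complex_hilbert_space)"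
  by (metis cinner_commute cinner_scaleC_left complex_cnj_mult)

lemma inner_i_left: "inner (\<i> *\<^sub>C x) y = - Im (cinner x (y :: 'a::complex_hilbert_space))"
  by (simp add: inner_eq_Re_cinner cinner_scaleC_left)

lemma inner_i_i: "inner (\<i> *\<^sub>C x) (\<i> *\<^sub>C y) = inner x (y :: 'a::complex_hilbert_space)"
  by (simp add: inner_eq_Re_cinner cinner_scaleC_left cinner_scaleC_right)

lemma inner_i_right: "inner x (\<i> *\<^sub>C y) = - inner (\<i> *\<^sub>C x) (y :: 'a::complex_hilbert_space)"
  using inner_i_i[of x "\<i> *\<^sub>C y"] by (simp add: scaleC_i_i)

lemma norm_i [simp]: "norm (\<i> *\<^sub>C x) = norm (x :: 'a::complex_hilbert_space)"
  by (simp add: norm_eq_sqrt_inner inner_i_i)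

lemma bounded_linear_i: "bounded_linear (\<lambda>x :: 'a::complex_hilbert_space. \<i> *\<^sub>C x)"
  by (rule bounded_linear_intro[where K = 1]) (simp_all add: scaleC_add_right scaleC_scaleR_commute)

text \<open>
  The real inner product determines the complex one, with the imaginary part read off after multiplication
  by \<open>i\<close>.
\<close>

lemma cinner_eq_iff_inner:
  fixes x y x' y' :: "'a::complex_hilbert_space"
  shows "cinner x y = cinner x' y' \<longleftrightarrow> inner x y = inner x' y' \<and> inner (\<i> *\<^sub>C x) y = inner (\<i> *\<^sub>C x') y'"
  by (auto simp: complex_eq_iff inner_i_left) (auto simp: inner_eq_Re_cinner)

lemma has_vector_derivative_at_0_iff:
  fixes u :: "real \<Rightarrow> 'a::real_normed_vector"
  shows "(u has_vector_derivative z) (at 0) \<longleftrightarrow> ((\<lambda>h. (u h - u 0) /\<^sub>R h) \<longlongrightarrow> z) (at 0)"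
proof -
  have "(u has_vector_derivative z) (at 0) \<longleftrightarrow> ((\<lambda>h. norm (u h - u 0 - h *\<^sub>R z) / norm h) \<longlongrightarrow> 0) (at 0)"
    by (simp add: has_vector_derivative_def has_derivative_at bounded_linear_scaleR_left)
  also have "\<dots> \<longleftrightarrow> ((\<lambda>h. norm ((u h - u 0) /\<^sub>R h - z)) \<longlongrightarrow> 0) (at 0)"
  proof (rule tendsto_cong)
    show "\<forall>\<^sub>F h in at 0. norm (u h - u 0 - h *\<^sub>R z) / norm h = norm ((u h - u 0) /\<^sub>R h - z)"
      unfolding eventually_at_filter
    proof (rule always_eventually, intro allI impI)
      fix h :: real assume h: "h \<noteq> 0"
      have "(u h - u 0) /\<^sub>R h - z = (u h - u 0 - h *\<^sub>R z) /\<^sub>R h" using h by (simp add: scaleR_diff_right)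
      then show "norm (u h - u 0 - h *\<^sub>R z) / norm h = norm ((u h - u 0) /\<^sub>R h - z)"
        by (simp add: divide_inverse mult.commute)
    qed
  qed
  also have "\<dots> \<longleftrightarrow> ((\<lambda>h. (u h - u 0) /\<^sub>R h) \<longlongrightarrow> z) (at 0)"
    by (simp add: tendsto_norm_zero_iff LIM_zero_iff)
  finally show ?thesis .
qed

text \<open>
  The complex adjoint relation is recovered from the real one by testing with both \<open>u\<close> and \<open>i u\<close>.
\<close>

lemma selfadjoint_imp_skew_adjoint:
  assumes sa: "selfadjoint D A"
  shows "skew_adjoint D (\<lambda>x. \<i> *\<^sub>C A x)"
proof
  show "closure D = UNIV" using sa by (simp add: selfadjoint_def)
  have lin: "clinear_on D A" using sa by (simp add: selfadjoint_def)
  have graph: "(\<forall>u\<in>D. cinner (A u) v = cinner u w) \<longleftrightarrow> v \<in> D \<and> w = A v" for v w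
    using sa by (auto simp: selfadjoint_def adjoint_graph_def set_eq_iff)
  fix v w
  have "(\<forall>u\<in>D. inner (\<i> *\<^sub>C A u) v = - inner u w) \<longleftrightarrow> (\<forall>u\<in>D. cinner (A u) v = cinner u (- (\<i> *\<^sub>C w)))"
    (is "?L \<longleftrightarrow> ?R")
  proof
    assume L: ?L
    show ?R
    proof
      fix u assume u: "u \<in> D"
      then have iu: "\<i> *\<^sub>C u \<in> D" "A (\<i> *\<^sub>C u) = \<i> *\<^sub>C A u"
        using lin by (auto simp: clinear_on_def)
      have "inner (A u) v = inner u (- (\<i> *\<^sub>C w))"
        using L[rule_format, OF iu(1)] by (simp add: iu(2) scaleC_i_i inner_i_right)
      moreover have "inner (\<i> *\<^sub>C A u) v = inner (\<i> *\<^sub>C u) (- (\<i> *\<^sub>C w))"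
        using L[rule_format, OF u] by (simp add: inner_i_i)
      ultimately show "cinner (A u) v = cinner u (- (\<i> *\<^sub>C w))" by (simp add: cinner_eq_iff_inner)
    qed
  next
    assume R: ?R
    show ?L
    proof
      fix u assume "u \<in> D"
      then show "inner (\<i> *\<^sub>C A u) v = - inner u w"
        using R[rule_format, of u] by (simp add: cinner_eq_iff_inner inner_i_i)
    qed
  qed
  also have "\<dots> \<longleftrightarrow> v \<in> D \<and> - (\<i> *\<^sub>C w) = A v" by (rule graph)
  also have "\<dots> \<longleftrightarrow> v \<in> D \<and> w = \<i> *\<^sub>C A v"
  proof -
    have "- (\<i> *\<^sub>C w) = A v \<longleftrightarrow> w = \<i> *\<^sub>C A v"
      by (metis scaleC_i_i scaleC_minus_right add.inverse_inverse)
    then show ?thesis by simp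
  qed
  finally show "(\<forall>u\<in>D. inner (\<i> *\<^sub>C A u) v = - inner u w) \<longleftrightarrow> v \<in> D \<and> w = \<i> *\<^sub>C A v" .
qed

lemma unitary_group_imp_orthogonal_group:
  assumes "unitary_group U"
  shows "orthogonal_group U"
proof
  have un: "unitary (U t)" for t using assms by (simp add: unitary_group_def)
  then have lin: "clinear_on UNIV (U t)" and iso: "cinner (U t x) (U t y) = cinner x y" for t x y
    by (simp_all add: unitary_def)
  fix s t :: real and x y :: 'a and c :: real
  show "U t (x + y) = U t x + U t y" "U t (c *\<^sub>R x) = c *\<^sub>R U t x"
    using lin by (simp_all add: clinear_on_def scaleR_scaleC)
  show "norm (U t x) = norm x" by (simp add: norm_eq_sqrt_inner inner_eq_Re_cinner iso)
  show "U 0 x = x" "U (s + t) x = U s (U t x)" "continuous_on UNIV (\<lambda>t. U t x)"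
    using assms by (simp_all add: unitary_group_def)
qed

lemma generator_graph_eq_iff:
  assumes "\<And>x. U 0 x = x"
  shows "generator_graph U = {(x, G x) | x. x \<in> D} \<longleftrightarrow>
    (\<forall>x z. ((\<lambda>t. U t x) has_vector_derivative z) (at 0) \<longleftrightarrow> x \<in> D \<and> z = G x)"
  unfolding has_vector_derivative_at_0_iff generator_graph_def set_eq_iff by (auto simp: assms)

lemma generated_group_imp_unitary_group:
  assumes "generated_group D (\<lambda>x. \<i> *\<^sub>C A x) U" and lin: "clinear_on D A"
  shows "unitary_group U"
proof -
  interpret generated_group D "\<lambda>x. \<i> *\<^sub>C A x" U by fact
  have i: "U t (\<i> *\<^sub>C x) = \<i> *\<^sub>C U t x" for t x
    by (rule U_commute[OF bounded_linear_i]) (use lin in \<open>auto simp: clinear_on_def\<close>)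
  have "unitary (U t)" for t
    unfolding unitary_def clinear_on_def
  proof (intro conjI allI ballI)
    fix c and x y :: 'a
    show "U t (c *\<^sub>C x) = c *\<^sub>C U t x"
      by (subst (1 2) scaleC_eq_Re_Im) (simp add: linear_add[OF linear] linear_cmul[OF linear] i)
    show "surj (U t)" using U_minus_cancel(2) by (metis surjI)
    show "cinner (U t x) (U t y) = cinner x y"
      unfolding cinner_eq_iff_inner i[symmetric] inner_eq by simp
  qed (simp_all add: linear_add[OF linear])
  then show ?thesis by (simp add: unitary_group_def U_add continuous)
qed

text \<open>
  Stone's theorem: the defining property of \<open>exp_i D A\<close> is satisfied by exactly one group, hence by \<open>exp_i D A\<close>.
\<close>

theorem exp_i_generated_group:
  assumes sa: "selfadjoint D A"
  shows "generated_group D (\<lambda>x. \<i> *\<^sub>C A x) (exp_i D A)"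
proof -
  interpret skew_adjoint D "\<lambda>x. \<i> *\<^sub>C A x" by (rule selfadjoint_imp_skew_adjoint[OF sa])
  have lin: "clinear_on D A" using sa by (simp add: selfadjoint_def)
  have iff: "unitary_group V \<and> generator_graph V = {(x, \<i> *\<^sub>C A x) | x. x \<in> D}
      \<longleftrightarrow> generated_group D (\<lambda>x. \<i> *\<^sub>C A x) V" for V
  proof (intro iffI conjI; (elim conjE)?)
    assume V: "unitary_group V" and gen: "generator_graph V = {(x, \<i> *\<^sub>C A x) | x. x \<in> D}"
    interpret orthogonal_group V by (rule unitary_group_imp_orthogonal_group[OF V])
    show "generated_group D (\<lambda>x. \<i> *\<^sub>C A x) V"
      by unfold_locales (use gen generator_graph_eq_iff[of V "\<lambda>x. \<i> *\<^sub>C A x" D] in simp)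
  next
    assume V: "generated_group D (\<lambda>x. \<i> *\<^sub>C A x) V"
    then interpret V: generated_group D "\<lambda>x. \<i> *\<^sub>C A x" V .
    show "unitary_group V" by (rule generated_group_imp_unitary_group[OF V lin])
    show "generator_graph V = {(x, \<i> *\<^sub>C A x) | x. x \<in> D}"
      using generator_graph_eq_iff[of V "\<lambda>x. \<i> *\<^sub>C A x" D] V.generator by simp
  qed
  have "exp_i D A = stone_group"
    unfolding exp_i_def iff
  proof (rule the_equality)
    show "generated_group D (\<lambda>x. \<i> *\<^sub>C A x) stone_group" by (rule generated_group_stone_group)
    fix V assume "generated_group D (\<lambda>x. \<i> *\<^sub>C A x) V"
    then show "V = stone_group"
      by (intro ext generated_group.generated_group_unique[OF generated_group_stone_group])
  qed
  then show ?thesis using generated_group_stone_group by simp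
qed

section \<open>Convergence of the regularized solution\<close>

theorem theorem4:
  fixes D :: "'a::complex_hilbert_space set"
    and A :: "'a \<Rightarrow> 'a"
    and f y :: 'a
    and a a' :: "real \<Rightarrow> real"
    and f\<delta> :: "real \<Rightarrow> 'a"
    and u :: "real \<Rightarrow> real \<Rightarrow> 'a"
  assumes "selfadjoint D A"
    and "y \<in> D" and "A y = f"
    and "\<forall>v \<in> null_space D A. cinner y v = 0"
    and "\<forall>t\<ge>0. a t > 0"
    and "continuous_on {0..} a"
    and "\<forall>t\<ge>0. (a has_real_derivative a' t) (at t within {0..})"
    and "antimono_on {0..} a"
    and "(a \<longlongrightarrow> 0) at_top"
    and "(\<lambda>t. a' t + (a t)\<^sup>2) absolutely_integrable_on {0<..}"
    and "filterlim (\<lambda>t. integral {0..t} a) at_top at_top"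
    and "\<forall>\<delta>>0. norm (f\<delta> \<delta> - f) \<le> \<delta>"
    and "\<forall>\<delta>>0. \<forall>t\<ge>0. u \<delta> t = mild_solution D A a (f\<delta> \<delta>) t"
  shows "\<exists>t\<delta> :: real \<Rightarrow> real.
    (\<forall>\<delta>>0. t\<delta> \<delta> \<ge> 0) \<and>
    filterlim t\<delta> at_top (at_right 0) \<and>
    ((\<lambda>\<delta>. norm (u \<delta> (t\<delta> \<delta>) - y)) \<longlongrightarrow> 0) (at_right 0)"
proof -
  let ?G = "\<lambda>x. \<i> *\<^sub>C A x" and ?U = "exp_i D A"
  interpret generated_group D ?G ?U by (rule exp_i_generated_group) fact
  interpret damping a a' by unfold_locales (use assms(5-11) in auto)
  interpret damped_group D ?G ?U a a' ..
  define I where "I t x = integral {0..t} (\<lambda>s. weight t s *\<^sub>R ?U (t - s) x)" for t x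
  have I_diff: "I t (x - z) = I t x - I t z" for t x z
    unfolding I_def linear_diff[OF linear] scaleR_diff_right by (rule integral_diff) (rule weight_integrable)+
  have I_bound: "norm (I t x) \<le> t * norm x" if "0 \<le> t" for t x
    unfolding I_def by (rule norm_weight_integral_le[OF that])
  have lim: "((\<lambda>t. I t (?G y)) \<longlongrightarrow> - y) at_top"
    unfolding I_def
  proof (rule regularized_solution_tendsto)
    fix v assume v: "v \<in> D" "\<i> *\<^sub>C A v = 0"
    then have "A v = 0" using scaleC_i_i[of "A v"] by simp
    with v have "cinner y v = 0" using assms(4) by (auto simp: null_space_def)
    then show "inner y v = 0" by (simp add: inner_eq_Re_cinner)
  qed fact
  have u: "u \<delta> t = I t ((- \<i>) *\<^sub>C f\<delta> \<delta>)" if "0 < \<delta>" "0 \<le> t" for \<delta> t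
  proof -
    have "u \<delta> t = mild_solution D A a (f\<delta> \<delta>) t" using assms(13) that by blast
    also have "\<dots> = I t ((- \<i>) *\<^sub>C f\<delta> \<delta>)"
      unfolding mild_solution_def I_def by (rule integral_cong) (simp add: integral_eq_total_damping_diff)
    finally show ?thesis .
  qed
  \<comment> \<open>\<open>?e\<close> is the error of the data after multiplication by \<open>- i\<close>.\<close>
  have dist: "norm (u \<delta> t - y) \<le> t * \<delta> + norm (I t (?G y) - (- y))" if \<delta>: "0 < \<delta>" and t: "0 \<le> t" for \<delta> t
  proof -
    let ?e = "(- \<i>) *\<^sub>C f\<delta> \<delta> - - ?G y"
    have "?e = - (\<i> *\<^sub>C (f\<delta> \<delta> - f))" by (simp add: assms(3) scaleC_uminus_left scaleC_diff_right)
    then have "norm ?e \<le> \<delta>" using assms(12) \<delta> by simp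
    then have err: "norm (I t ?e) \<le> t * \<delta>" using I_bound[OF t, of ?e] t by (meson mult_left_mono order_trans)
    have eq: "u \<delta> t - y = I t ?e - (I t (?G y) - (- y))"
      using I_diff[of t "(- \<i>) *\<^sub>C f\<delta> \<delta>" "- ?G y"] I_diff[of t 0 "?G y"] I_diff[of t 0 0] u[OF \<delta> t] by simp
    have "norm (u \<delta> t - y) \<le> norm (I t ?e) + norm (I t (?G y) - (- y))"
      unfolding eq by (rule norm_triangle_ineq4)
    with err show ?thesis by linarith
  qed
  \<comment> \<open>Any choice with \<open>t\<delta> \<delta> \<rightarrow> \<infinity>\<close> and \<open>t\<delta> \<delta> * \<delta> \<rightarrow> 0\<close> would do.\<close>
  define t\<delta> where "t\<delta> \<delta> = inverse (sqrt \<delta>)" for \<delta> :: real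
  have top: "filterlim t\<delta> at_top (at_right 0)"
    unfolding t\<delta>_def
  proof (rule filterlim_inverse_at_top)
    show "((\<lambda>\<delta>. sqrt \<delta>) \<longlongrightarrow> 0) (at_right 0)"
      using tendsto_real_sqrt[OF tendsto_ident_at[of 0 "{0<..}"]] by simp
    show "\<forall>\<^sub>F \<delta> in at_right 0. 0 < sqrt \<delta>"
      by (simp add: eventually_at_right_less)
  qed
  have "((\<lambda>\<delta>. norm (u \<delta> (t\<delta> \<delta>) - y)) \<longlongrightarrow> 0) (at_right 0)"
  proof (rule tendsto_sandwich[of "\<lambda>_. 0"])
    show "\<forall>\<^sub>F \<delta> in at_right 0. norm (u \<delta> (t\<delta> \<delta>) - y) \<le> sqrt \<delta> + norm (I (t\<delta> \<delta>) (?G y) - (- y))"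
      unfolding eventually_at_right_field
    proof (intro exI[of _ 1] conjI allI impI)
      fix \<delta> :: real assume \<delta>: "0 < \<delta>"
      have "t\<delta> \<delta> * \<delta> = sqrt \<delta>" using \<delta> by (simp add: t\<delta>_def field_simps)
      then show "norm (u \<delta> (t\<delta> \<delta>) - y) \<le> sqrt \<delta> + norm (I (t\<delta> \<delta>) (?G y) - (- y))"
        using dist[OF \<delta>, of "t\<delta> \<delta>"] \<delta> by (simp add: t\<delta>_def)
    qed simp
    have "((\<lambda>\<delta>. norm (I (t\<delta> \<delta>) (?G y) - (- y))) \<longlongrightarrow> 0) (at_right 0)"
      by (rule tendsto_norm_zero[OF LIM_zero[OF filterlim_compose[OF lim top]]])
    moreover have "((\<lambda>\<delta>. sqrt \<delta>) \<longlongrightarrow> sqrt 0) (at_right 0)" by (intro tendsto_intros)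
    ultimately show "((\<lambda>\<delta>. sqrt \<delta> + norm (I (t\<delta> \<delta>) (?G y) - (- y))) \<longlongrightarrow> 0) (at_right 0)"
      using tendsto_add by fastforce
  qed simp_all
  moreover have "\<forall>\<delta>>0. t\<delta> \<delta> \<ge> 0" by (simp add: t\<delta>_def)
  ultimately show ?thesis using top by blast
qed

end
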